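(* Let $\tau\ge2$ be an integer, $\rho$ an integer relatively prime to $2\tau$, $\theta=\rho\pi/\tau$, $\omega=e^{i\theta}$, $G$ a matrix of rank $r$ with column set $E$, and $\mathbb{A}$ of order $q$, in the setting described in the context. For $k=0,\dots,2\tau-1$ let $\mathcal{M}_{1,\tau-1}(k,2\tau)$ be the set of pairs $(f,g)$ of functions $f,g:E\to\mathbb{A}$ such that $f-g$ is a flow of $G$ over $\mathbb{A}$ and $|\mathrm{supp}(f)|+(\tau-1)|\mathrm{supp}(g)|\equiv k\pmod{2\tau}$. Then $$\sum_{k=0}^{2\tau-1}\omega^k|\mathcal{M}_{1,\tau-1}(k,2\tau)| = (-2i\sin\theta)^r(2i\sin\theta+2-q)^{|E|-r}\,R\!\left(M(G);\frac{-q(2i\sin\theta+2-q)}{2i\sin\theta},\frac{-2i\sin\theta}{2i\sin\theta+2-q}\right).$$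
   Context: $i=\sqrt{-1}$. Setting (the paper's hypothesis "$G$ is a totally-$\mathbb{P}$ matrix and $\mathbb{A}$ a $\mathbb{P}$-module of order $q$", read as the following cases): either (i) $G$ is the vertex–edge or cycle–edge matrix of a graph with edge set $E$, or a totally unimodular matrix, and $\mathbb{A}$ is an Abelian group of order $q$; or (ii) $G$ is a matrix over $\mathrm{GF}(p^s)$, $\mathbb{A}=\mathrm{GF}(p^s)^d$, $q=p^{sd}$. With $H$ a matrix orthogonally dual to $G$ (same columns, rows of $H$ orthogonal to rows of $G$, ranks summing to $|E|$; integer in case (i)), a flow of $G$ over $\mathbb{A}$ is $h:E\to\mathbb{A}$ with $Hh^T=0$ (equivalently an $\mathbb{A}$-combination of rows of $G$). $\mathrm{supp}(f)=\{e: f(e)\ne0\}$. $M(G)$ is the matroid on $E$ of linear dependence of the columns of $G$, rank function $\mathrm{rk}$, rank $r$; $R(M;\lambda,x)=\sum_{B\subseteq E}\lambda^{r-\mathrm{rk}(B)}x^{|B|-\mathrm{rk}(B)}$.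
   Formalization: In case (i), the dual matrix H must itself be a vertex–edge, cycle–edge or totally unimodular matrix, not just any integer matrix: for G=(1 1), H=(3 −3), A=Z/3, every h satisfies Hhᵀ=0 and the formula fails. *)

theory Defs
  imports
    "HOL-Analysis.Finite_Cartesian_Product"
    "HOL-Library.FuncSet"
    "HOL-Number_Theory.Cong"
    "Jordan_Normal_Form.Determinant"
    "Graph_Theory.Arc_Walk"
begin

text \<open>
  A matrix with finite row index set \<open>I\<close> and finite column index set \<open>E\<close> is a function
  \<open>M :: 'i \<Rightarrow> 'e \<Rightarrow> 'r\<close> of which only the entries in \<open>I \<times> E\<close> matter.
\<close>

section \<open>The column matroid and its rank generating polynomial\<close>

definition indep_cols :: "'i set \<Rightarrow> ('i \<Rightarrow> 'e \<Rightarrow> 'k::field) \<Rightarrow> 'e set \<Rightarrow> bool" where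
  "indep_cols I M X \<longleftrightarrow>
     (\<forall>c. (\<forall>i\<in>I. (\<Sum>e\<in>X. c e * M i e) = 0) \<longrightarrow> (\<forall>e\<in>X. c e = 0))"

definition col_rk :: "'i set \<Rightarrow> ('i \<Rightarrow> 'e \<Rightarrow> 'k::field) \<Rightarrow> 'e set \<Rightarrow> nat" where
  "col_rk I M B = Max (card ` {X. X \<subseteq> B \<and> indep_cols I M X})"

text \<open>
  Here \<open>rk\<close> is the rank function of a matroid on \<open>E\<close>; the natural number subtractions are
  proper, as \<open>rk B \<le> rk E\<close> and \<open>rk B \<le> card B\<close>.
\<close>
definition rank_poly :: "('e set \<Rightarrow> nat) \<Rightarrow> 'e set \<Rightarrow> complex \<Rightarrow> complex \<Rightarrow> complex" where
  "rank_poly rk E l x = (\<Sum>B\<in>Pow E. l ^ (rk E - rk B) * x ^ (card B - rk B))"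

definition orthogonally_dual ::
    "'e set \<Rightarrow> 'i set \<Rightarrow> ('i \<Rightarrow> 'e \<Rightarrow> 'k::field) \<Rightarrow> 'j set \<Rightarrow> ('j \<Rightarrow> 'e \<Rightarrow> 'k) \<Rightarrow> bool" where
  "orthogonally_dual E I G J H \<longleftrightarrow>
     (\<forall>i\<in>I. \<forall>j\<in>J. (\<Sum>e\<in>E. G i e * H j e) = 0) \<and>
     col_rk I G E + col_rk J H E = card E"

definition rat_matrix :: "('i \<Rightarrow> 'e \<Rightarrow> int) \<Rightarrow> 'i \<Rightarrow> 'e \<Rightarrow> rat" where
  "rat_matrix M i e = of_int (M i e)"

section \<open>Totally unimodular, vertex-edge and cycle-edge matrices\<close>

definition totally_unimodular :: "'i set \<Rightarrow> 'e set \<Rightarrow> ('i \<Rightarrow> 'e \<Rightarrow> int) \<Rightarrow> bool" where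
  "totally_unimodular I E M \<longleftrightarrow>
     (\<forall>n row col. inj_on row {..<n} \<and> row ` {..<n} \<subseteq> I \<and> inj_on col {..<n} \<and> col ` {..<n} \<subseteq> E
        \<longrightarrow> Determinant.det (mat n n (\<lambda>(a, b). M (row a) (col b))) \<in> {-1, 0, 1})"

text \<open>
  A graph (loops and parallel edges allowed) is given with an arbitrary reference orientation of
  its edges, as a \<^term>\<open>fin_digraph\<close> whose arcs are the edges. A loop has a zero
  column in the vertex-edge matrix.
\<close>
definition vertex_edge_matrix ::
    "('v, 'e) pre_digraph \<Rightarrow> 'i set \<Rightarrow> 'e set \<Rightarrow> ('i \<Rightarrow> 'e \<Rightarrow> int) \<Rightarrow> bool" where
  "vertex_edge_matrix D I E M \<longleftrightarrow> fin_digraph D \<and> arcs D = E \<and>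
     (\<exists>vert. bij_betw vert I (verts D) \<and>
       (\<forall>i\<in>I. \<forall>e\<in>E. M i e = of_bool (head D e = vert i) - of_bool (tail D e = vert i)))"

text \<open>
  Each edge \<open>e\<close> becomes two arcs: \<open>(e, True)\<close> traverses \<open>e\<close> along its reference orientation and
  \<open>(e, False)\<close> against it. A cycle of the underlying undirected graph is a directed cycle here
  that uses no edge twice; this only excludes going back and forth along one edge.
\<close>
definition both_ways :: "('v, 'e) pre_digraph \<Rightarrow> ('v, 'e \<times> bool) pre_digraph" where
  "both_ways D = \<lparr>verts = verts D, arcs = arcs D \<times> UNIV,
     tail = (\<lambda>(e, b). if b then tail D e else head D e),
     head = (\<lambda>(e, b). if b then head D e else tail D e)\<rparr>"

definition traversed_cycle :: "('v, 'e) pre_digraph \<Rightarrow> ('e \<times> bool) list \<Rightarrow> bool" where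
  "traversed_cycle D p \<longleftrightarrow> pre_digraph.cycle (both_ways D) p \<and> distinct (map fst p)"

definition cycle_vector :: "('e \<times> bool) list \<Rightarrow> 'e \<Rightarrow> int" where
  "cycle_vector p e = of_bool ((e, True) \<in> set p) - of_bool ((e, False) \<in> set p)"

text \<open>
  A cycle is determined by its edge set. There is exactly one row for each cycle, obtained by
  choosing one of its traversals \<open>cyc i\<close>.
\<close>
definition cycle_edge_matrix ::
    "('v, 'e) pre_digraph \<Rightarrow> 'i set \<Rightarrow> 'e set \<Rightarrow> ('i \<Rightarrow> 'e \<Rightarrow> int) \<Rightarrow> bool" where
  "cycle_edge_matrix D I E M \<longleftrightarrow> fin_digraph D \<and> arcs D = E \<and>
     (\<exists>cyc. (\<forall>i\<in>I. traversed_cycle D (cyc i)) \<and>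
       bij_betw (\<lambda>i. fst ` set (cyc i)) I {fst ` set p |p. traversed_cycle D p} \<and>
       (\<forall>i\<in>I. \<forall>e\<in>E. M i e = cycle_vector (cyc i) e))"

definition regular_matrix ::
    "('v, 'e) pre_digraph \<Rightarrow> 'i set \<Rightarrow> 'e set \<Rightarrow> ('i \<Rightarrow> 'e \<Rightarrow> int) \<Rightarrow> bool" where
  "regular_matrix D I E M \<longleftrightarrow>
     vertex_edge_matrix D I E M \<or> cycle_edge_matrix D I E M \<or> totally_unimodular I E M"

section \<open>Flows\<close>

text \<open>The action of the integers on an Abelian group; one of the two sums is empty.\<close>
definition int_scale :: "int \<Rightarrow> 'a::ab_group_add \<Rightarrow> 'a" where
  "int_scale n a = (\<Sum>_<nat n. a) - (\<Sum>_<nat (- n). a)"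

text \<open>
  The flows of \<open>G\<close> are the solutions of \<open>H h\<^sup>T = 0\<close>, where \<open>H\<close> is orthogonally dual to \<open>G\<close>.
  For integer matrices \<open>H\<close> has to be a \<^term>\<open>regular_matrix\<close> like \<open>G\<close>: otherwise one could
  multiply \<open>H\<close> by the order of the group and every \<open>h\<close> would be a solution.
\<close>
definition is_flow ::
    "('r \<Rightarrow> 'a \<Rightarrow> 'a::ab_group_add) \<Rightarrow> 'e set \<Rightarrow> 'j set \<Rightarrow> ('j \<Rightarrow> 'e \<Rightarrow> 'r) \<Rightarrow> ('e \<Rightarrow> 'a) \<Rightarrow> bool" where
  "is_flow smul E J H h \<longleftrightarrow> (\<forall>j\<in>J. (\<Sum>e\<in>E. smul (H j e) (h e)) = 0)"

definition supp_on :: "'e set \<Rightarrow> ('e \<Rightarrow> 'a::zero) \<Rightarrow> 'e set" where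
  "supp_on E f = {e \<in> E. f e \<noteq> 0}"

definition flow_pairs ::
    "'e set \<Rightarrow> (('e \<Rightarrow> 'a::ab_group_add) \<Rightarrow> bool) \<Rightarrow> nat \<Rightarrow> nat \<Rightarrow> nat \<Rightarrow> nat
      \<Rightarrow> (('e \<Rightarrow> 'a) \<times> ('e \<Rightarrow> 'a)) set" where
  "flow_pairs E flow a b k m =
     {(f, g). f \<in> E \<rightarrow>\<^sub>E UNIV \<and> g \<in> E \<rightarrow>\<^sub>E UNIV \<and> flow (\<lambda>e. f e - g e) \<and>
        [a * card (supp_on E f) + b * card (supp_on E g) = k] (mod m)}"

end

theory Submission
  imports Defs "Graph_Theory.Digraph_Component"
begin

text \<open>
  Since \<open>\<omega> ^ \<tau> = -1\<close>, the left-hand side is the sum over all pairs \<open>(f, g)\<close> of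
  \<open>\<omega> ^ |supp f| * (- 1 / \<omega>) ^ |supp g|\<close>. Fixing the flow \<open>h = f - g\<close> makes it a product over the
  edges, where an edge contributes \<open>t = S + 2 - q\<close> with \<open>S = \<omega> - 1 / \<omega> = 2 \<i> sin \<theta>\<close> if \<open>h\<close> does not
  vanish there, and \<open>t - S\<close> if it does. Expanding this product over edge sets \<open>B\<close> leaves the number
  of flows vanishing on \<open>B\<close>, which is \<open>q ^ (r - rk B)\<close>. As \<open>S\<close> is a nonzero imaginary number, \<open>t\<close> is
  nonzero and the resulting sum is the rank polynomial.

  The flows vanishing on \<open>B\<close> are the kernel of \<open>H\<close> restricted to the columns \<open>E - B\<close>. Its size is
  determined by a unimodular column basis of this restriction: it comes from a maximal nonzero minor
  for totally unimodular matrices, from a rooted spanning forest for vertex-edge matrices, and from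
  fundamental circuits for cycle-edge matrices. Matroid duality relates its rank to that of \<open>G\<close>.
\<close>

section \<open>Column bases\<close>

text \<open>
  The row vectors \<open>w c * H\<close> are integral (when \<open>'r\<close> is \<open>int\<close>) and dual to the columns \<open>C\<close>, and
  they generate all rows of \<open>H\<close> restricted to \<open>X\<close>. Hence over every \<open>'r\<close>-module the solutions
  on \<open>X\<close> are parametrized freely by their values on \<open>X - C\<close>.
\<close>
definition col_basis ::
    "'j set \<Rightarrow> ('j \<Rightarrow> 'e \<Rightarrow> 'r::comm_ring_1) \<Rightarrow> 'e set \<Rightarrow> 'e set \<Rightarrow> ('e \<Rightarrow> 'j \<Rightarrow> 'r) \<Rightarrow> bool" where
  "col_basis J H X C w \<longleftrightarrow> C \<subseteq> X \<and>
     (\<forall>c\<in>C. \<forall>c'\<in>C. (\<Sum>j\<in>J. w c j * H j c') = of_bool (c = c')) \<and>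
     (\<forall>j\<in>J. \<forall>x\<in>X. H j x = (\<Sum>c\<in>C. (\<Sum>i\<in>J. w c i * H i x) * H j c))"

lemma col_basisI:
  assumes "C \<subseteq> X"
    and "\<And>c c'. c \<in> C \<Longrightarrow> c' \<in> C \<Longrightarrow> (\<Sum>j\<in>J. w c j * H j c') = of_bool (c = c')"
    and "\<And>j x. j \<in> J \<Longrightarrow> x \<in> X \<Longrightarrow> H j x = (\<Sum>c\<in>C. (\<Sum>i\<in>J. w c i * H i x) * H j c)"
  shows "col_basis J H X C w"
  unfolding col_basis_def using assms by blast

lemma col_basis_subset: "col_basis J H X C w \<Longrightarrow> C \<subseteq> X"
  by (simp add: col_basis_def)

lemma col_basis_dual:
  "col_basis J H X C w \<Longrightarrow> c \<in> C \<Longrightarrow> c' \<in> C \<Longrightarrow> (\<Sum>j\<in>J. w c j * H j c') = of_bool (c = c')"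
  by (simp add: col_basis_def)

lemma col_basis_span:
  "col_basis J H X C w \<Longrightarrow> j \<in> J \<Longrightarrow> x \<in> X \<Longrightarrow>
     H j x = (\<Sum>c\<in>C. (\<Sum>i\<in>J. w c i * H i x) * H j c)"
  unfolding col_basis_def by blast

text \<open>An integral basis remains one over the rationals, which is where its size can be
  compared with the rank \<open>col_rk\<close>.\<close>

lemma col_basis_rat_matrix:
  assumes "col_basis J H X C w"
  shows "col_basis J (rat_matrix H) X C (\<lambda>c j. of_int (w c j))"
proof (rule col_basisI)
  show "C \<subseteq> X" by (rule col_basis_subset[OF assms])
next
  fix c c' assume "c \<in> C" "c' \<in> C"
  then have "of_int (\<Sum>j\<in>J. w c j * H j c') = (of_int (of_bool (c = c')) :: rat)"
    using col_basis_dual[OF assms] by presburger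
  then show "(\<Sum>j\<in>J. of_int (w c j) * rat_matrix H j c') = of_bool (c = c')"
    by (simp add: rat_matrix_def)
next
  fix j x assume "j \<in> J" "x \<in> X"
  then have "(of_int (H j x) :: rat) = of_int (\<Sum>c\<in>C. (\<Sum>i\<in>J. w c i * H i x) * H j c)"
    using col_basis_span[OF assms] by presburger
  then show "rat_matrix H j x =
      (\<Sum>c\<in>C. (\<Sum>i\<in>J. of_int (w c i) * rat_matrix H i x) * rat_matrix H j c)"
    by (simp add: rat_matrix_def)
qed

text \<open>Gaussian elimination by columns: a column \<open>z\<close> that is nonzero in row
  \<open>c\<close> clears this row in all other columns, which leaves a system with one row and one
  column fewer.\<close>

lemma homogeneous_system_solution:
  fixes m :: "'c \<Rightarrow> 'e \<Rightarrow> 'k::field"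
  assumes "finite C" "finite Y" "card C < card Y"
  shows "\<exists>a. (\<exists>y\<in>Y. a y \<noteq> 0) \<and> (\<forall>c\<in>C. (\<Sum>y\<in>Y. a y * m c y) = 0)"
  using assms
proof (induction C arbitrary: Y m rule: finite_induct)
  case empty
  then have "Y \<noteq> {}" by auto
  then show ?case by (intro exI[of _ "\<lambda>_. 1"]) auto
next
  case (insert c C)
  show ?case
  proof (cases "\<forall>y\<in>Y. m c y = 0")
    case True
    have "card C < card Y" using insert by simp
    from insert.IH[OF insert.prems(1) this, of m]
    obtain a where a: "\<exists>y\<in>Y. a y \<noteq> 0" "\<forall>c\<in>C. (\<Sum>y\<in>Y. a y * m c y) = 0" by blast
    then show ?thesis using True by (intro exI[of _ a]) auto
  next
    case False
    then obtain z where z: "z \<in> Y" "m c z \<noteq> 0" by blast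
    define Z where "Z = Y - {z}"
    have Y: "Y = insert z Z" "z \<notin> Z" "finite Z" using z insert.prems by (auto simp: Z_def)
    have "card C < card Z" using insert Y by simp
    from insert.IH[OF Y(3) this, of "\<lambda>d y. m d y - m c y / m c z * m d z"]
    obtain a where a: "\<exists>y\<in>Z. a y \<noteq> 0"
      "\<And>d. d \<in> C \<Longrightarrow> (\<Sum>y\<in>Z. a y * (m d y - m c y / m c z * m d z)) = 0" by blast
    \<comment> \<open>A relation among the cleared columns becomes one among the original columns
      once the multiples of column \<open>z\<close> are collected.\<close>
    define s where "s = (\<Sum>y\<in>Z. a y * m c y) / m c z"
    define b where "b = a(z := - s)"
    have sum_b: "(\<Sum>y\<in>Y. b y * m d y) = - s * m d z + (\<Sum>y\<in>Z. a y * m d y)" for d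
    proof -
      have "(\<Sum>y\<in>Z. b y * m d y) = (\<Sum>y\<in>Z. a y * m d y)"
        using Y(2) by (intro sum.cong) (auto simp: b_def)
      then show ?thesis using Y by (simp add: b_def)
    qed
    have "(\<Sum>y\<in>Y. b y * m d y) = 0" if "d \<in> C" for d
    proof -
      have "0 = (\<Sum>y\<in>Z. a y * m d y - a y * m c y * (m d z / m c z))"
        using a(2)[OF that] by (simp add: algebra_simps)
      also have "\<dots> = (\<Sum>y\<in>Z. a y * m d y) - (\<Sum>y\<in>Z. a y * m c y) * (m d z / m c z)"
        by (simp add: sum_subtractf sum_distrib_right sum_divide_distrib)
      finally show ?thesis unfolding sum_b s_def by simp
    qed
    moreover have "(\<Sum>y\<in>Y. b y * m c y) = 0" unfolding sum_b s_def using z by simp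
    moreover have "\<exists>y\<in>Y. b y \<noteq> 0" using a(1) Y by (auto simp: b_def)
    ultimately show ?thesis by (intro exI[of _ b]) auto
  qed
qed

text \<open>Pairing a linear relation among the columns with the dual row vector \<open>w d\<close>
  isolates the coefficient of \<open>d\<close>.\<close>

lemma col_basis_indep:
  fixes H :: "'j \<Rightarrow> 'e \<Rightarrow> 'k::field"
  assumes "col_basis J H X C w" "finite X"
  shows "indep_cols J H C"
  unfolding indep_cols_def
proof (intro allI impI ballI)
  fix a d assume a: "\<forall>j\<in>J. (\<Sum>e\<in>C. a e * H j e) = 0" and d: "d \<in> C"
  have fC: "finite C" using assms col_basis_subset finite_subset by metis
  have "0 = (\<Sum>j\<in>J. w d j * (\<Sum>e\<in>C. a e * H j e))" using a by simp
  also have "\<dots> = (\<Sum>e\<in>C. a e * (\<Sum>j\<in>J. w d j * H j e))"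
    by (subst (1 2) sum_distrib_left, subst sum.swap) (simp add: mult_ac)
  also have "\<dots> = (\<Sum>e\<in>C. a e * of_bool (d = e))"
    using col_basis_dual[OF assms(1) d] by (intro sum.cong) auto
  also have "\<dots> = a d" using fC d by (simp add: of_bool_def if_distrib cong: if_cong)
  finally show "a d = 0" by simp
qed

text \<open>Steinitz's bound: if \<open>Y\<close> were larger than \<open>C\<close>, the coefficient
  columns of \<open>m\<close> would be linearly dependent, and the same relation would hold among
  the columns of \<open>H\<close> in \<open>Y\<close>.\<close>

lemma indep_cols_card_le:
  fixes H :: "'j \<Rightarrow> 'e \<Rightarrow> 'k::field"
  assumes "finite C" "finite Y" and Y: "indep_cols J H Y"
    and span: "\<And>j y. j \<in> J \<Longrightarrow> y \<in> Y \<Longrightarrow> H j y = (\<Sum>c\<in>C. m c y * H j c)"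
  shows "card Y \<le> card C"
proof (rule ccontr)
  assume "\<not> ?thesis"
  then obtain a where a: "\<exists>y\<in>Y. a y \<noteq> 0" "\<And>c. c \<in> C \<Longrightarrow> (\<Sum>y\<in>Y. a y * m c y) = 0"
    using homogeneous_system_solution[of C Y m] assms(1,2) by auto
  have "(\<Sum>y\<in>Y. a y * H j y) = 0" if "j \<in> J" for j
  proof -
    have "(\<Sum>y\<in>Y. a y * H j y) = (\<Sum>y\<in>Y. a y * (\<Sum>c\<in>C. m c y * H j c))"
      using span[OF that] by (intro sum.cong) auto
    also have "\<dots> = (\<Sum>c\<in>C. (\<Sum>y\<in>Y. a y * m c y) * H j c)"
      by (subst sum_distrib_left, subst sum_distrib_right, subst sum.swap) (simp add: mult_ac)
    finally show ?thesis using a(2) by simp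
  qed
  then show False using Y a(1) unfolding indep_cols_def by blast
qed

lemma card_indep_le_col_rk:
  assumes "finite B" "X \<subseteq> B" "indep_cols J H X"
  shows "card X \<le> col_rk J H B"
  unfolding col_rk_def using assms by (intro Max_ge) auto

lemma col_rk_eq:
  fixes H :: "'j \<Rightarrow> 'e \<Rightarrow> 'k::field"
  assumes "finite X" "C \<subseteq> X" "indep_cols J H C"
    and "\<And>j x. j \<in> J \<Longrightarrow> x \<in> X \<Longrightarrow> H j x = (\<Sum>c\<in>C. m c x * H j c)"
  shows "col_rk J H X = card C"
proof -
  have "card Y \<le> card C" if "Y \<subseteq> X" "indep_cols J H Y" for Y
    using that assms by (intro indep_cols_card_le[where m = m and J = J and H = H])
      (auto intro: finite_subset)
  then show ?thesis
    unfolding col_rk_def using assms by (intro Max_eqI) auto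
qed

lemma col_basis_col_rk:
  fixes H :: "'j \<Rightarrow> 'e \<Rightarrow> 'k::field"
  assumes "col_basis J H X C w" "finite X"
  shows "col_rk J H X = card C"
  by (rule col_rk_eq[OF assms(2) col_basis_subset[OF assms(1)] col_basis_indep[OF assms]
        col_basis_span[OF assms(1)]])

text \<open>If column \<open>x\<close> is not yet spanned by \<open>C\<close>, a row
  \<open>k\<close> in which its residue \<open>y\<close> is nonzero serves as a pivot.\<close>

lemma col_basis_insert:
  fixes H :: "'j \<Rightarrow> 'e \<Rightarrow> 'k::field"
  assumes "finite J" "finite X" and b: "col_basis J H X C w" and x: "x \<notin> X"
  shows "\<exists>C' w'. col_basis J H (insert x X) C' w' \<and> C \<subseteq> C' \<and> C' \<subseteq> insert x C"
proof -
  have C: "C \<subseteq> X" "finite C" "x \<notin> C"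
    using col_basis_subset[OF b] x finite_subset[OF _ assms(2)] by auto
  define v where "v c y = (\<Sum>i\<in>J. w c i * H i y)" for c y
  define y where "y j = H j x - (\<Sum>c\<in>C. v c x * H j c)" for j
  have dual: "v c c' = of_bool (c = c')" if "c \<in> C" "c' \<in> C" for c c'
    using col_basis_dual[OF b that] by (simp add: v_def)
  have span: "H j z = (\<Sum>c\<in>C. v c z * H j c)" if "j \<in> J" "z \<in> X" for j z
    using col_basis_span[OF b that] by (simp add: v_def)
  show ?thesis
  proof (cases "\<forall>j\<in>J. y j = 0")
    case True
    then have "col_basis J H (insert x X) C w"
      using C dual span by (intro col_basisI) (auto simp: v_def[symmetric] y_def)
    then show ?thesis by blast
  next
    case False
    then obtain k where k: "k \<in> J" "y k \<noteq> 0" by blast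
    \<comment> \<open>The row \<open>t\<close>, which is \<open>u\<close> times \<open>H\<close>, is
      row \<open>k\<close> minus its expansion in the rows \<open>v c\<close>, scaled: it vanishes
      on \<open>X\<close> and is 1 at \<open>x\<close>. Subtracting \<open>v c x\<close> times
      \<open>u\<close> makes the old dual rows vanish at \<open>x\<close>.\<close>
    define u where "u j = (of_bool (j = k) - (\<Sum>c\<in>C. H k c * w c j)) / y k" for j
    define w' where "w' c j = (if c = x then u j else w c j - v c x * u j)" for c j
    define t where "t z = (\<Sum>j\<in>J. u j * H j z)" for z
    have t: "t z = (H k z - (\<Sum>c\<in>C. v c z * H k c)) / y k" for z
    proof -
      have "(\<Sum>j\<in>J. of_bool (j = k) * H j z) = H k z"
        using assms(1) k by (simp add: of_bool_def if_distrib[of "\<lambda>a. a * _"] cong: if_cong)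
      moreover have "(\<Sum>j\<in>J. (\<Sum>c\<in>C. H k c * w c j) * H j z) = (\<Sum>c\<in>C. v c z * H k c)"
        unfolding v_def sum_distrib_right by (subst sum.swap) (simp add: mult_ac)
      ultimately show ?thesis
        by (simp add: t_def u_def left_diff_distrib sum_subtractf flip: sum_divide_distrib)
    qed
    have tX: "t z = 0" if "z \<in> X" for z using span[OF k(1) that] by (simp add: t)
    have tx: "t x = 1" using k by (simp add: t y_def)
    have "(\<Sum>j\<in>J. (w c j - a * u j) * H j z) = v c z - a * t z" for a c z
      by (simp add: t_def v_def left_diff_distrib sum_subtractf sum_distrib_left mult.assoc)
    then have v': "(\<Sum>j\<in>J. w' c j * H j z) = (if c = x then t z else v c z - v c x * t z)" for c z
      by (simp add: w'_def t_def)
    have "col_basis J H (insert x X) (insert x C) w'"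
    proof (rule col_basisI)
      show "insert x C \<subseteq> insert x X" using C by auto
    next
      fix c c' assume "c \<in> insert x C" "c' \<in> insert x C"
      then show "(\<Sum>j\<in>J. w' c j * H j c') = of_bool (c = c')"
        unfolding v' using C tX tx dual by auto
    next
      fix j z assume j: "j \<in> J" and z: "z \<in> insert x X"
      have "(\<Sum>c\<in>insert x C. (\<Sum>i\<in>J. w' c i * H i z) * H j c)
          = t z * H j x + (\<Sum>c\<in>C. (v c z - v c x * t z) * H j c)"
        unfolding v' using C by (subst sum.insert) (auto intro!: sum.cong)
      also have "\<dots> = t z * y j + (\<Sum>c\<in>C. v c z * H j c)"
        by (simp add: y_def algebra_simps sum_subtractf sum_distrib_left)
      also have "\<dots> = H j z"
        using z span[OF j] tX tx by (cases "z = x") (auto simp: y_def)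
      finally show "H j z = (\<Sum>c\<in>insert x C. (\<Sum>i\<in>J. w' c i * H i z) * H j c)" ..
    qed
    then show ?thesis by blast
  qed
qed

text \<open>That the added basis columns lie outside \<open>X\<close> is what the count in the
  duality of ranks relies on.\<close>

lemma col_basis_extend:
  fixes H :: "'j \<Rightarrow> 'e \<Rightarrow> 'k::field"
  assumes "finite J" "finite Y" "X \<subseteq> Y" "col_basis J H X C w"
  shows "\<exists>C' w'. col_basis J H Y C' w' \<and> C \<subseteq> C' \<and> C' \<subseteq> C \<union> (Y - X)"
proof -
  have "finite (Y - X)" using assms by simp
  moreover have "\<exists>C' w'. col_basis J H (X \<union> D) C' w' \<and> C \<subseteq> C' \<and> C' \<subseteq> C \<union> D"
    if "finite D" "D \<subseteq> Y - X" for D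
    using that
  proof (induction D rule: finite_induct)
    case empty
    then show ?case using assms by auto
  next
    case (insert x D)
    then obtain C' w' where C': "col_basis J H (X \<union> D) C' w'" "C \<subseteq> C'" "C' \<subseteq> C \<union> D" by auto
    have "finite (X \<union> D)" using assms insert finite_subset by blast
    from col_basis_insert[OF assms(1) this C'(1), of x] insert
    obtain C'' w'' where "col_basis J H (insert x (X \<union> D)) C'' w''" "C' \<subseteq> C''" "C'' \<subseteq> insert x C'"
      by auto
    then show ?case using C' by (intro exI[of _ C''] exI[of _ w'']) auto
  qed
  ultimately have "\<exists>C' w'. col_basis J H (X \<union> (Y - X)) C' w' \<and> C \<subseteq> C' \<and> C' \<subseteq> C \<union> (Y - X)"
    by blast
  then show ?thesis using assms(3) by (simp add: Un_absorb1)
qed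

lemma col_basis_empty: "col_basis J H {} {} w"
  by (auto simp: col_basis_def)

lemma col_basis_exists:
  fixes H :: "'j \<Rightarrow> 'e \<Rightarrow> 'k::field"
  assumes "finite J" "finite X"
  shows "\<exists>C w. col_basis J H X C w"
  using col_basis_extend[OF assms empty_subsetI col_basis_empty[of _ _ "\<lambda>_ _. 0"]] by blast

section \<open>Dual ranks\<close>

lemma orthogonally_dual_sym:
  "orthogonally_dual E I G J H \<Longrightarrow> orthogonally_dual E J H I G"
  unfolding orthogonally_dual_def by (auto simp: mult.commute add.commute)

text \<open>The complement of a basis \<open>C\<close> of \<open>G\<close> is independent in
  \<open>H\<close>. If \<open>C\<close> extends a basis \<open>C0\<close> of \<open>B\<close>, the
  part of this complement outside \<open>B\<close> is an independent subset of \<open>E - B\<close>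
  of the required size.\<close>

lemma dual_col_rk_le:
  fixes G :: "'i \<Rightarrow> 'e \<Rightarrow> 'k::field" and H :: "'j \<Rightarrow> 'e \<Rightarrow> 'k"
  assumes fin: "finite I" "finite J" "finite E" and d: "orthogonally_dual E I G J H" and B: "B \<subseteq> E"
  shows "card (E - B) + col_rk I G B \<le> col_rk J H (E - B) + col_rk I G E"
proof -
  have fB: "finite B" using fin B finite_subset by blast
  obtain C0 w0 where 0: "col_basis I G B C0 w0" using col_basis_exists[OF fin(1) fB] by blast
  from col_basis_extend[OF fin(1,3) B 0]
  obtain C w where C: "col_basis I G E C w" "C0 \<subseteq> C" "C \<subseteq> C0 \<union> (E - B)" by blast
  have CE: "C \<subseteq> E" "finite C" using col_basis_subset[OF C(1)] fin finite_subset by auto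
  have C0B: "C0 \<subseteq> B" by (rule col_basis_subset[OF 0])
  have rk: "card C = col_rk I G E" "card C0 = col_rk I G B"
    using col_basis_col_rk[OF C(1) fin(3)] col_basis_col_rk[OF 0 fB] by auto
  define v where "v c y = (\<Sum>i\<in>I. w c i * G i y)" for c y
  have orth: "(\<Sum>e\<in>E. v c e * H j e) = 0" if "j \<in> J" for c j
  proof -
    have "(\<Sum>e\<in>E. v c e * H j e) = (\<Sum>i\<in>I. w c i * (\<Sum>e\<in>E. G i e * H j e))"
      unfolding v_def sum_distrib_right sum_distrib_left by (subst sum.swap) (simp add: mult_ac)
    then show ?thesis using d that by (simp add: orthogonally_dual_def)
  qed
  \<comment> \<open>On \<open>C\<close> the combination \<open>v c\<close> of rows of
    \<open>G\<close> is the unit vector of \<open>c\<close>. Its orthogonality to row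
    \<open>j\<close> of \<open>H\<close> therefore expresses column \<open>c\<close> by the columns
    off \<open>C\<close>.\<close>
  have Hc: "H j c = (\<Sum>x\<in>E - C. - v c x * H j x)" if "j \<in> J" "c \<in> C" for j c
  proof -
    have "0 = (\<Sum>e\<in>C. v c e * H j e) + (\<Sum>x\<in>E - C. v c x * H j x)"
      using orth[OF that(1), of c] sum.subset_diff[OF CE(1) fin(3), of "\<lambda>e. v c e * H j e"]
      by (simp add: add.commute)
    also have "(\<Sum>e\<in>C. v c e * H j e) = (\<Sum>e\<in>C. of_bool (c = e) * H j e)"
      using col_basis_dual[OF C(1) that(2)] by (intro sum.cong) (auto simp: v_def)
    also have "\<dots> = H j c" using CE that(2)
      by (simp add: of_bool_def if_distrib[of "\<lambda>a. a * _"] cong: if_cong)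
    finally show ?thesis by (simp add: sum_negf eq_neg_iff_add_eq_0)
  qed
  \<comment> \<open>By \<open>Hc\<close>, the columns in \<open>E - C\<close> span all columns of
    \<open>H\<close>. A basis \<open>F\<close> among them has as many elements as the rank of
    \<open>H\<close>, which is \<open>card (E - C)\<close>, so \<open>F\<close> exhausts
    \<open>E - C\<close>.\<close>
  have indep: "indep_cols J H (E - C)"
  proof -
    have fEC: "finite (E - C)" using fin by simp
    obtain F u where F: "col_basis J H (E - C) F u" using col_basis_exists[OF fin(2) fEC] by blast
    have FE: "F \<subseteq> E - C" by (rule col_basis_subset[OF F])
    define m where "m f x = (\<Sum>i\<in>J. u f i * H i x)" for f x
    have 1: "H j x = (\<Sum>f\<in>F. m f x * H j f)" if "j \<in> J" "x \<in> E - C" for j x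
      using col_basis_span[OF F that] by (simp add: m_def)
    have "H j x = (\<Sum>f\<in>F. m f x * H j f)" if "j \<in> J" "x \<in> E" for j x
    proof (cases "x \<in> C")
      case True
      have m: "m f x = (\<Sum>y\<in>E - C. - v x y * m f y)" for f
      proof -
        have "m f x = (\<Sum>i\<in>J. u f i * (\<Sum>y\<in>E - C. - v x y * H i y))"
          unfolding m_def using Hc[OF _ True] by (intro sum.cong) auto
        also have "\<dots> = (\<Sum>y\<in>E - C. - v x y * m f y)"
          unfolding m_def sum_distrib_left by (subst sum.swap) (simp add: mult_ac)
        finally show ?thesis .
      qed
      have "H j x = (\<Sum>y\<in>E - C. - v x y * (\<Sum>f\<in>F. m f y * H j f))"
        unfolding Hc[OF that(1) True] using 1[OF that(1)] by (intro sum.cong) auto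
      also have "\<dots> = (\<Sum>f\<in>F. m f x * H j f)"
        unfolding m sum_distrib_left sum_distrib_right by (subst sum.swap) (simp add: mult_ac)
      finally show ?thesis .
    qed (use 1 that in blast)
    then have "col_rk J H E = card F"
      using col_rk_eq[OF fin(3) _ col_basis_indep[OF F fEC], of m] FE by blast
    then have "card F = card (E - C)"
      using d rk(1) card_Diff_subset[OF CE(2,1)] unfolding orthogonally_dual_def by linarith
    then have "F = E - C" using FE fEC by (simp add: card_subset_eq)
    then show ?thesis using col_basis_indep[OF F fEC] by simp
  qed
  have ind': "indep_cols J H (E - (C \<union> B))"
    unfolding indep_cols_def
  proof (intro allI impI ballI)
    fix a e assume a: "\<forall>j\<in>J. (\<Sum>e\<in>E - (C \<union> B). a e * H j e) = 0" and e: "e \<in> E - (C \<union> B)"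
    \<comment> \<open>A relation on the smaller set, extended by zero, is a relation on
      \<open>E - C\<close>.\<close>
    have "(\<Sum>e\<in>E - C. (if e \<in> B then 0 else a e) * H j e) = (\<Sum>e\<in>E - (C \<union> B). a e * H j e)" for j
      using fin by (intro sum.mono_neutral_cong_right) auto
    then have "\<forall>e\<in>E - C. (if e \<in> B then 0 else a e) = 0"
      using indep[unfolded indep_cols_def, rule_format, of "\<lambda>e. if e \<in> B then 0 else a e"] a by auto
    from bspec[OF this, of e] show "a e = 0" using e by auto
  qed
  have "card (E - (C \<union> B)) \<le> col_rk J H (E - B)"
    by (rule card_indep_le_col_rk[OF _ _ ind']) (use fin in auto)
  \<comment> \<open>\<open>C\<close> meets \<open>B\<close> only in \<open>C0\<close>, since the
    extension of \<open>C0\<close> added columns outside \<open>B\<close> only.\<close>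
  moreover have "card (E - B) = card (E - (C \<union> B)) + card (C - C0)"
  proof -
    have "E - B = (E - (C \<union> B)) \<union> (C - C0)" using C C0B CE by auto
    moreover have "card ((E - (C \<union> B)) \<union> (C - C0)) = card (E - (C \<union> B)) + card (C - C0)"
      by (rule card_Un_disjoint) (use fin CE in auto)
    ultimately show ?thesis by simp
  qed
  moreover have "card (C - C0) = card C - card C0"
    by (rule card_Diff_subset[OF finite_subset[OF C(2) CE(2)] C(2)])
  moreover have "card C0 \<le> card C" by (rule card_mono[OF CE(2) C(2)])
  ultimately show ?thesis using rk by linarith
qed

text \<open>The rank formula of the dual matroid. The second inequality is the first one with
  \<open>G\<close> and \<open>H\<close> exchanged and \<open>B\<close> replaced by its
  complement.\<close>

lemma dual_col_rk:
  fixes G :: "'i \<Rightarrow> 'e \<Rightarrow> 'k::field" and H :: "'j \<Rightarrow> 'e \<Rightarrow> 'k"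
  assumes fin: "finite I" "finite J" "finite E" and d: "orthogonally_dual E I G J H" and B: "B \<subseteq> E"
  shows "card (E - B) + col_rk I G B = col_rk J H (E - B) + col_rk I G E"
proof (rule antisym)
  show "card (E - B) + col_rk I G B \<le> col_rk J H (E - B) + col_rk I G E"
    by (rule dual_col_rk_le[OF assms])
  have "E - (E - B) = B" using B by auto
  then have "card B + col_rk J H (E - B) \<le> col_rk I G B + col_rk J H E"
    using dual_col_rk_le[OF fin(2,1,3) orthogonally_dual_sym[OF d], of "E - B"] by simp
  moreover have "col_rk I G E + col_rk J H E = card E" using d by (simp add: orthogonally_dual_def)
  moreover have "card E = card B + card (E - B)"
    using B fin by (metis card_Diff_subset card_mono finite_subset le_add_diff_inverse)
  ultimately show "col_rk J H (E - B) + col_rk I G E \<le> card (E - B) + col_rk I G B" by linarith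
qed

section \<open>Counting kernels\<close>

text \<open>The kernel is the graph of a map from the values on \<open>X - C\<close> to those on
  \<open>C\<close>. A general scalar action covers Abelian groups over the integers as well as
  vector spaces.\<close>

lemma card_kernel:
  fixes H :: "'j \<Rightarrow> 'e \<Rightarrow> 'r::comm_ring_1" and scale :: "'r \<Rightarrow> 'b \<Rightarrow> 'b::{ab_group_add,finite}"
  assumes "Modules.module scale" and b: "col_basis J H X C w" and X: "finite X"
  shows "card {h \<in> X \<rightarrow>\<^sub>E UNIV. \<forall>j\<in>J. (\<Sum>x\<in>X. scale (H j x) (h x)) = 0} = CARD('b) ^ (card X - card C)"
proof -
  interpret Modules.module scale by fact
  have C: "C \<subseteq> X" "finite C" using col_basis_subset[OF b] finite_subset[OF _ X] by auto
  define v where "v c y = (\<Sum>i\<in>J. w c i * H i y)" for c y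
  have dual: "v c c' = of_bool (c = c')" if "c \<in> C" "c' \<in> C" for c c'
    using col_basis_dual[OF b that] by (simp add: v_def)
  have span: "H j z = (\<Sum>c\<in>C. v c z * H j c)" if "j \<in> J" "z \<in> X" for j z
    using col_basis_span[OF b that] by (simp add: v_def)
  have split: "(\<Sum>x\<in>X. scale (v c x) (h x)) = h c + (\<Sum>x\<in>X - C. scale (v c x) (h x))"
    if "c \<in> C" for c h
  proof -
    have "(\<Sum>x\<in>C. scale (v c x) (h x)) = (\<Sum>x\<in>C. if c = x then h x else 0)"
      using dual[OF that] by (intro sum.cong) auto
    also have "\<dots> = h c" using C that by simp
    finally show ?thesis
      using sum.subset_diff[OF C(1) X, of "\<lambda>x. scale (v c x) (h x)"] by (simp add: add.commute)
  qed
  \<comment> \<open>The rows \<open>v c\<close> are combinations of the rows of \<open>H\<close> and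
    conversely, so both systems have the same solutions; the system of the \<open>v c\<close> is
    already solved for the coordinates in \<open>C\<close>.\<close>
  have ker: "(\<forall>j\<in>J. (\<Sum>x\<in>X. scale (H j x) (h x)) = 0) \<longleftrightarrow>
      (\<forall>c\<in>C. h c = - (\<Sum>x\<in>X - C. scale (v c x) (h x)))" for h
  proof -
    have 1: "(\<Sum>x\<in>X. scale (v c x) (h x)) = (\<Sum>j\<in>J. scale (w c j) (\<Sum>x\<in>X. scale (H j x) (h x)))" for c
      unfolding v_def scale_sum_left scale_sum_right by (subst sum.swap) simp
    have 2: "(\<Sum>x\<in>X. scale (H j x) (h x)) = (\<Sum>c\<in>C. scale (H j c) (\<Sum>x\<in>X. scale (v c x) (h x)))"
      if "j \<in> J" for j
    proof -
      have "(\<Sum>x\<in>X. scale (H j x) (h x)) = (\<Sum>x\<in>X. \<Sum>c\<in>C. scale (v c x * H j c) (h x))"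
        using span[OF that] by (intro sum.cong) (auto simp flip: scale_sum_left)
      also have "\<dots> = (\<Sum>c\<in>C. scale (H j c) (\<Sum>x\<in>X. scale (v c x) (h x)))"
        unfolding scale_sum_right by (subst sum.swap) (simp add: mult.commute)
      finally show ?thesis .
    qed
    have "(\<forall>j\<in>J. (\<Sum>x\<in>X. scale (H j x) (h x)) = 0) \<longleftrightarrow> (\<forall>c\<in>C. (\<Sum>x\<in>X. scale (v c x) (h x)) = 0)"
    proof (intro iffI ballI)
      fix c assume "\<forall>j\<in>J. (\<Sum>x\<in>X. scale (H j x) (h x)) = 0"
      then show "(\<Sum>x\<in>X. scale (v c x) (h x)) = 0" unfolding 1[of c] by simp
    next
      fix j assume "\<forall>c\<in>C. (\<Sum>x\<in>X. scale (v c x) (h x)) = 0" "j \<in> J"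
      then show "(\<Sum>x\<in>X. scale (H j x) (h x)) = 0" using 2[of j] by simp
    qed
    then show ?thesis using split by (simp add: eq_neg_iff_add_eq_0)
  qed
  define K where "K = {h \<in> X \<rightarrow>\<^sub>E (UNIV :: 'b set). \<forall>c\<in>C. h c = - (\<Sum>x\<in>X - C. scale (v c x) (h x))}"
  have "bij_betw (\<lambda>h. restrict h (X - C)) K ((X - C) \<rightarrow>\<^sub>E UNIV)"
  proof (rule bij_betw_byWitness[where
        f' = "\<lambda>h x. if x \<in> C then - (\<Sum>x'\<in>X - C. scale (v x x') (h x')) else h x"], goal_cases)
    case 1
    show ?case
    proof (intro ballI ext)
      fix h x assume h: "h \<in> K"
      have eq: "(\<Sum>x'\<in>X - C. scale (v x x') (restrict h (X - C) x')) = (\<Sum>x'\<in>X - C. scale (v x x') (h x'))"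
        by (intro sum.cong) auto
      show "(if x \<in> C then - (\<Sum>x'\<in>X - C. scale (v x x') (restrict h (X - C) x'))
          else restrict h (X - C) x) = h x"
      proof (cases "x \<in> C")
        case True
        then have "h x = - (\<Sum>x'\<in>X - C. scale (v x x') (h x'))" using h by (simp add: K_def)
        then show ?thesis unfolding if_P[OF True] eq by (rule sym)
      next
        case False
        have "h \<in> extensional X" using h by (simp add: K_def PiE_def)
        then show ?thesis using False by (auto simp: extensional_def restrict_def)
      qed
    qed
  next
    case 2
    show ?case by (intro ballI ext) (auto simp: PiE_def extensional_def restrict_def)
  next
    case 3
    show ?case by (auto simp: K_def)
  next
    case 4
    have "(\<lambda>x. if x \<in> C then - (\<Sum>x'\<in>X - C. scale (v x x') (h x')) else h x) \<in> K"
      if "h \<in> (X - C) \<rightarrow>\<^sub>E UNIV" for h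
    proof -
      have "(\<Sum>x\<in>X - C. scale (v c x) (if x \<in> C then g x else h x)) = (\<Sum>x\<in>X - C. scale (v c x) (h x))" for c g
        by (intro sum.cong) auto
      then show ?thesis using that C by (auto simp: K_def PiE_def extensional_def)
    qed
    then show ?case by blast
  qed
  then have "card K = card ((X - C) \<rightarrow>\<^sub>E (UNIV :: 'b set))" by (rule bij_betw_same_card)
  also have "\<dots> = CARD('b) ^ (card X - card C)"
    using X C by (simp add: card_PiE card_Diff_subset)
  finally show ?thesis unfolding K_def ker .
qed

section \<open>Totally unimodular matrices\<close>

text \<open>A largest nonvanishing minor has a unit as determinant and hence an integral inverse;
  the vanishing of all minors that border it makes the remaining columns combinations of the chosen
  ones.\<close>

lemma totally_unimodular_col_basis:
  assumes tu: "totally_unimodular J E H" and J: "finite J" and X: "X \<subseteq> E" "finite X"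
  shows "\<exists>C w. col_basis J H X C w"
proof -
  define minor where "minor n row col \<longleftrightarrow>
      inj_on row {..<n} \<and> row ` {..<n} \<subseteq> J \<and> inj_on col {..<n} \<and> col ` {..<n} \<subseteq> X \<and>
      Determinant.det (Matrix.mat n n (\<lambda>(a, b). H (row a) (col b))) \<noteq> 0"
    for n :: nat and row col
  have bound: "n \<le> card X" if "minor n row col" for n row col
    using that card_inj_on_le[of col "{..<n}" X] X by (simp add: minor_def)
  \<comment> \<open>The empty minor has determinant 1, so there is a nonvanishing minor to start
    from.\<close>
  have "minor 0 (\<lambda>_. undefined) (\<lambda>_. undefined)" by (simp add: minor_def)
  then have "\<exists>row col. minor 0 row col" by blast
  then have "\<exists>m. (\<exists>row col. minor m row col) \<and> (\<forall>k. (\<exists>row col. minor k row col) \<longrightarrow> k \<le> m)"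
    by (rule ex_has_greatest_nat[where f = "\<lambda>n. n" and b = "Suc (card X)"])
      (use bound in \<open>auto simp: less_Suc_eq_le\<close>)
  then obtain n row col where minor: "minor n row col"
    and max: "\<And>n' row' col'. minor n' row' col' \<Longrightarrow> n' \<le> n"
    by blast
  have row: "inj_on row {..<n}" "row ` {..<n} \<subseteq> J" and col: "inj_on col {..<n}" "col ` {..<n} \<subseteq> X"
    using minor by (auto simp: minor_def)
  define M where "M = Matrix.mat n n (\<lambda>(a, b). H (row a) (col b))"
  have M: "M \<in> carrier_mat n n" by (simp add: M_def)
  have "Determinant.det M \<noteq> 0" using minor by (simp add: minor_def M_def)
  moreover have "Determinant.det M \<in> {-1, 0, 1}"
    using tu row col X unfolding totally_unimodular_def M_def by (meson order_trans)
  ultimately have d: "Determinant.det M * Determinant.det M = 1" by auto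
  \<comment> \<open>The determinant is 1 or -1 and so its own inverse; thus \<open>r\<close> is the
    integral inverse of \<open>M\<close>.\<close>
  define r where "r a b = Determinant.det M * adj_mat M $$ (a, b)" for a b
  have adj: "adj_mat M \<in> carrier_mat n n" using adj_mat(1)[OF M] .
  have rM: "(\<Sum>b<n. r a b * H (row b) (col a')) = of_bool (a = a')" if "a < n" "a' < n" for a a'
  proof -
    have "(\<Sum>b<n. r a b * H (row b) (col a')) = Determinant.det M * (adj_mat M * M) $$ (a, a')"
      using that M adj by (simp add: r_def M_def scalar_prod_def sum_distrib_left mult.assoc lessThan_atLeast0)
    then show ?thesis using that d by (simp add: adj_mat(3)[OF M])
  qed
  have Mr: "(\<Sum>b<n. H (row a) (col b) * r b a') = of_bool (a = a')" if "a < n" "a' < n" for a a'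
  proof -
    have "(\<Sum>b<n. H (row a) (col b) * r b a') = Determinant.det M * (M * adj_mat M) $$ (a, a')"
      using that M adj by (simp add: r_def M_def scalar_prod_def sum_distrib_left mult_ac lessThan_atLeast0)
    then show ?thesis using that d by (simp add: adj_mat(2)[OF M])
  qed
  \<comment> \<open>The rows of the inverse are placed at the chosen row indices and padded with
    zeros.\<close>
  define w where "w c j = (if j \<in> row ` {..<n}
      then r (inv_into {..<n} col c) (inv_into {..<n} row j) else 0)" for c j
  define v where "v a x = (\<Sum>b<n. r a b * H (row b) x)" for a x
  have w: "(\<Sum>j\<in>J. w (col a) j * H j x) = v a x" if "a < n" for a x
  proof -
    have "(\<Sum>j\<in>J. w (col a) j * H j x) = (\<Sum>j\<in>row ` {..<n}. w (col a) j * H j x)"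
      using J row by (intro sum.mono_neutral_right) (auto simp: w_def)
    also have "\<dots> = (\<Sum>b<n. w (col a) (row b) * H (row b) x)"
      by (simp add: sum.reindex[OF row(1)])
    also have "\<dots> = v a x"
      unfolding v_def using that row col by (intro sum.cong) (auto simp: w_def inv_into_f_f)
    finally show ?thesis .
  qed
  have span: "H j x = (\<Sum>a<n. v a x * H j (col a))" if j: "j \<in> J" and x: "x \<in> X" for j x
  proof (cases "j \<in> row ` {..<n}")
    case True
    then obtain b' where b': "b' < n" "j = row b'" by auto
    have "(\<Sum>a<n. v a x * H j (col a)) = (\<Sum>b<n. (\<Sum>a<n. H j (col a) * r a b) * H (row b) x)"
      unfolding v_def sum_distrib_right by (subst sum.swap) (simp add: mult_ac)
    also have "\<dots> = (\<Sum>b<n. if b' = b then H (row b) x else 0)"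
      using b' Mr by (intro sum.cong) auto
    also have "\<dots> = H j x" using b' by simp
    finally show ?thesis ..
  next
    case j': False
    show ?thesis
    proof (cases "x \<in> col ` {..<n}")
      case True
      then obtain b' where b': "b' < n" "x = col b'" by auto
      have "(\<Sum>a<n. v a x * H j (col a)) = (\<Sum>a<n. if a = b' then H j (col a) else 0)"
        unfolding v_def using b' rM by (intro sum.cong) auto
      also have "\<dots> = H j x" using b' by simp
      finally show ?thesis ..
    next
      case x': False
      \<comment> \<open>Bordering \<open>M\<close> by row \<open>j\<close> and column
        \<open>x\<close> gives a larger minor, which is zero by maximality. Its kernel vector
        relates column \<open>x\<close> to the chosen columns; the last entry is nonzero because
        \<open>M\<close> is invertible.\<close>
      define row' col' where "row' = row(n := j)" and "col' = col(n := x)"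
      define M' where "M' = Matrix.mat (Suc n) (Suc n) (\<lambda>(a, b). H (row' a) (col' b))"
      have M': "M' \<in> carrier_mat (Suc n) (Suc n)" by (simp add: M'_def)
      have "inj_on row' {..<Suc n}" "row' ` {..<Suc n} \<subseteq> J"
          "inj_on col' {..<Suc n}" "col' ` {..<Suc n} \<subseteq> X"
        using row col j j' x x' by (auto simp: row'_def col'_def lessThan_Suc inj_on_def)
      then have "Determinant.det M' = 0"
        using max[of "Suc n" row' col'] by (auto simp: minor_def M'_def)
      then obtain z where z: "z \<in> carrier_vec (Suc n)" "z \<noteq> 0\<^sub>v (Suc n)" "M' *\<^sub>v z = 0\<^sub>v (Suc n)"
        using det_0_iff_vec_prod_zero[OF M'] by blast
      define y where "y b = Matrix.vec_index z b" for b
      have eq: "(\<Sum>b<n. H (row' a) (col b) * y b) + H (row' a) x * y n = 0" if "a < Suc n" for a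
      proof -
        have "0 = Matrix.vec_index (M' *\<^sub>v z) a" unfolding z(3) using that by simp
        also have "\<dots> = (\<Sum>b<Suc n. H (row' a) (col' b) * y b)"
          using that M' z(1) by (simp add: M'_def scalar_prod_def y_def lessThan_atLeast0)
        also have "\<dots> = (\<Sum>b<n. H (row' a) (col b) * y b) + H (row' a) x * y n"
          by (simp add: col'_def)
        finally show ?thesis by simp
      qed
      have y: "y a = - v a x * y n" if a: "a < n" for a
      proof -
        have "0 = (\<Sum>b<n. r a b * ((\<Sum>b'<n. H (row b) (col b') * y b') + H (row b) x * y n))"
        proof (intro sum.neutral[symmetric] ballI)
          fix b assume "b \<in> {..<n}"
          then show "r a b * ((\<Sum>b'<n. H (row b) (col b') * y b') + H (row b) x * y n) = 0"
            using eq[of b] by (simp add: row'_def)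
        qed
        also have "\<dots> = (\<Sum>b<n. \<Sum>b'<n. r a b * H (row b) (col b') * y b') + v a x * y n"
          by (simp add: distrib_left sum.distrib sum_distrib_left v_def sum_distrib_right mult.assoc)
        also have "(\<Sum>b<n. \<Sum>b'<n. r a b * H (row b) (col b') * y b')
            = (\<Sum>b'<n. (\<Sum>b<n. r a b * H (row b) (col b')) * y b')"
          unfolding sum_distrib_right by (rule sum.swap)
        also have "\<dots> = (\<Sum>b'<n. if a = b' then y b' else 0)"
          using rM[OF a] by (intro sum.cong) auto
        also have "\<dots> = y a" using a by simp
        finally show ?thesis by simp
      qed
      have "y n \<noteq> 0"
      proof
        assume 0: "y n = 0"
        then have "y a = 0" if "a < Suc n" for a using y that by (auto simp: less_Suc_eq)
        then have "z = 0\<^sub>v (Suc n)" using z(1) by (intro eq_vecI) (auto simp: y_def)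
        with z(2) show False by simp
      qed
      moreover have "y n * (H j x - (\<Sum>a<n. v a x * H j (col a))) = 0"
      proof -
        have "(\<Sum>b<n. H j (col b) * y b) = (\<Sum>b<n. H j (col b) * (- v b x * y n))"
          using y by (intro sum.cong) auto
        then show ?thesis using eq[of n]
          by (simp add: row'_def algebra_simps sum_negf sum_distrib_left)
      qed
      ultimately show ?thesis by simp
    qed
  qed
  have "col_basis J H X (col ` {..<n}) w"
  proof (rule col_basisI)
    fix c c' assume "c \<in> col ` {..<n}" "c' \<in> col ` {..<n}"
    then obtain a a' where a: "a < n" "a' < n" "c = col a" "c' = col a'" by auto
    then have "(\<Sum>j\<in>J. w c j * H j c') = of_bool (a = a')" using w rM by (simp add: v_def)
    then show "(\<Sum>j\<in>J. w c j * H j c') = of_bool (c = c')"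
      using a col by (auto simp: inj_on_def)
  next
    fix j x assume "j \<in> J" "x \<in> X"
    then have "H j x = (\<Sum>a<n. (\<Sum>i\<in>J. w (col a) i * H i x) * H j (col a))"
      by (subst span) (auto simp: w intro!: sum.cong)
    then show "H j x = (\<Sum>c\<in>col ` {..<n}. (\<Sum>i\<in>J. w c i * H i x) * H j c)"
      by (simp add: sum.reindex[OF col(1)])
  qed (use col in auto)
  then show ?thesis by blast
qed

section \<open>Vertex-edge matrices\<close>

text \<open>
  The function \<open>rt\<close> sends a vertex to the root of its component in the forest \<open>C\<close>, and \<open>w c\<close> is
  the signed indicator of the vertices that \<open>c\<close> separates from their root.
\<close>
lemma incidence_forest:
  fixes hd tl :: "'e \<Rightarrow> 'i"
  assumes "finite X"
  defines "M \<equiv> \<lambda>i e. of_bool (hd e = i) - of_bool (tl e = i) :: int"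
  shows "\<exists>C w rt. C \<subseteq> X \<and> (\<forall>x\<in>X. rt (hd x) = rt (tl x)) \<and>
    (\<forall>c\<in>C. \<forall>c'\<in>C. w c (hd c') - w c (tl c') = of_bool (c = c')) \<and>
    (\<forall>u j. of_bool (u = j) - of_bool (rt u = j) = (\<Sum>c\<in>C. w c u * M j c))"
  using assms(1)
proof (induction X rule: finite_induct)
  case empty
  show ?case by (intro exI[of _ "{}"] exI[of _ "\<lambda>_ _. 0"] exI[of _ "\<lambda>u. u"]) auto
next
  case (insert x X)
  from insert.IH obtain C w rt where C: "C \<subseteq> X" and rt: "\<And>x. x \<in> X \<Longrightarrow> rt (hd x) = rt (tl x)"
    and dual: "\<And>c c'. c \<in> C \<Longrightarrow> c' \<in> C \<Longrightarrow> w c (hd c') - w c (tl c') = of_bool (c = c')"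
    and span: "\<And>u j. of_bool (u = j) - of_bool (rt u = j) = (\<Sum>c\<in>C. w c u * M j c)"
    by blast
  show ?case
  proof (cases "rt (hd x) = rt (tl x)")
    case True
    then show ?thesis
      using C rt dual span by (intro exI[of _ C] exI[of _ w] exI[of _ rt]) auto
  next
    case False
    have x: "x \<notin> C" "finite C" using C insert.hyps finite_subset by auto
    define a b where "a = rt (hd x)" and "b = rt (tl x)"
    have ab: "a \<noteq> b" using False by (simp add: a_def b_def)
    \<comment> \<open>The edge \<open>x\<close> hangs the tree rooted at \<open>a\<close> below the
      root \<open>b\<close>. From there the path to \<open>b\<close> now runs through
      \<open>a\<close>, \<open>hd x\<close> and \<open>tl x\<close>, which subtracts
      \<open>v c\<close> from \<open>w c\<close>.\<close>
    define v where "v c = w c (hd x) - w c (tl x)" for c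
    define rt' where "rt' u = (if rt u = a then b else rt u)" for u
    define w' where "w' c u = (if c = x then of_bool (rt u = a) else w c u - v c * of_bool (rt u = a))"
      for c u
    have "w' c (hd c') - w' c (tl c') = of_bool (c = c')"
      if "c \<in> insert x C" "c' \<in> insert x C" for c c'
    proof (cases "c = x"; cases "c' = x")
      assume "c \<noteq> x" "c' = x"
      then show ?thesis using ab by (simp add: w'_def v_def flip: a_def b_def)
    next
      assume "c = x" "c' = x"
      then show ?thesis using ab by (simp add: w'_def flip: a_def b_def)
    next
      assume "c = x" "c' \<noteq> x"
      then show ?thesis using that rt[of c'] C by (auto simp: w'_def)
    next
      assume "c \<noteq> x" "c' \<noteq> x"
      then have "c \<in> C" "c' \<in> C" "rt (hd c') = rt (tl c')" using that C rt by auto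
      then show ?thesis using dual[of c c'] \<open>c \<noteq> x\<close> by (simp add: w'_def)
    qed
    moreover have "of_bool (u = j) - of_bool (rt' u = j) = (\<Sum>c\<in>insert x C. w' c u * M j c)" for u j
    proof -
      have v: "(\<Sum>c\<in>C. v c * M j c) = M j x + of_bool (b = j) - of_bool (a = j)"
      proof -
        have "(\<Sum>c\<in>C. v c * M j c) = (\<Sum>c\<in>C. w c (hd x) * M j c) - (\<Sum>c\<in>C. w c (tl x) * M j c)"
          by (simp add: v_def left_diff_distrib sum_subtractf)
        then show ?thesis unfolding span[symmetric] by (simp add: M_def a_def b_def)
      qed
      have "(\<Sum>c\<in>insert x C. w' c u * M j c)
          = of_bool (rt u = a) * M j x + (\<Sum>c\<in>C. (w c u - v c * of_bool (rt u = a)) * M j c)"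
      proof -
        have "(\<Sum>c\<in>C. w' c u * M j c) = (\<Sum>c\<in>C. (w c u - v c * of_bool (rt u = a)) * M j c)"
          using x by (intro sum.cong) (auto simp: w'_def)
        then show ?thesis using x by (simp add: w'_def)
      qed
      also have "\<dots> = (\<Sum>c\<in>C. w c u * M j c) + of_bool (rt u = a) * (M j x - (\<Sum>c\<in>C. v c * M j c))"
        by (simp add: algebra_simps sum_subtractf sum_distrib_left)
      also have "\<dots> = of_bool (u = j) - of_bool (rt' u = j)"
        unfolding v span[symmetric] by (auto simp: rt'_def)
      finally show ?thesis ..
    qed
    moreover have "rt' (hd z) = rt' (tl z)" if "z \<in> insert x X" for z
      using that rt ab by (auto simp: rt'_def a_def b_def)
    ultimately show ?thesis using C
      by (intro exI[of _ "insert x C"] exI[of _ w'] exI[of _ rt']) auto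
  qed
qed

text \<open>Heads and tails are pulled back along \<open>vert\<close> to row indices, so that the
  forest lives on \<open>J\<close> itself.\<close>

lemma vertex_edge_col_basis:
  assumes H: "vertex_edge_matrix D J E H" and J: "finite J" and X: "X \<subseteq> E" "finite X"
  shows "\<exists>C w. col_basis J H X C w"
proof -
  from H obtain vert where D: "fin_digraph D" "arcs D = E" and vert: "bij_betw vert J (verts D)"
    and H': "\<And>i e. i \<in> J \<Longrightarrow> e \<in> E \<Longrightarrow> H i e = of_bool (head D e = vert i) - of_bool (tail D e = vert i)"
    unfolding vertex_edge_matrix_def by blast
  interpret fin_digraph D by fact
  define hd tl where "hd e = inv_into J vert (head D e)" and "tl e = inv_into J vert (tail D e)" for e
  have ht: "hd e \<in> J" "tl e \<in> J" if "e \<in> E" for e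
    using that D vert by (auto simp: hd_def tl_def bij_betw_def intro!: inv_into_into)
  have "vert (hd e) = head D e" "vert (tl e) = tail D e" if "e \<in> E" for e
    using that D vert by (auto simp: hd_def tl_def bij_betw_def intro!: f_inv_into_f)
  then have HM: "H i e = of_bool (hd e = i) - of_bool (tl e = i)" if "i \<in> J" "e \<in> E" for i e
    using that ht H' vert by (auto simp: bij_betw_def inj_on_def)
  obtain C w rt where C: "C \<subseteq> X" and rt: "\<And>x. x \<in> X \<Longrightarrow> rt (hd x) = rt (tl x)"
    and dual: "\<And>c c'. c \<in> C \<Longrightarrow> c' \<in> C \<Longrightarrow> w c (hd c') - w c (tl c') = of_bool (c = c')"
    and span: "\<And>u j. of_bool (u = j) - of_bool (rt u = j)
      = (\<Sum>c\<in>C. w c u * (of_bool (hd c = j) - of_bool (tl c = j) :: int))"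
    using incidence_forest[OF X(2), of hd tl] by blast
  have w: "(\<Sum>j\<in>J. w c j * H j x) = w c (hd x) - w c (tl x)" if "x \<in> E" for c x
  proof -
    have "(\<Sum>j\<in>J. w c j * H j x)
        = (\<Sum>j\<in>J. if hd x = j then w c j else 0) - (\<Sum>j\<in>J. if tl x = j then w c j else 0)"
      unfolding sum_subtractf[symmetric] using HM that by (intro sum.cong) auto
    then show ?thesis using J ht[OF that] by simp
  qed
  have "col_basis J H X C w"
  proof (rule col_basisI[OF C])
    fix c c' assume "c \<in> C" "c' \<in> C"
    then show "(\<Sum>j\<in>J. w c j * H j c') = of_bool (c = c')"
      using w[of c' c] dual C X by auto
  next
    fix j x assume j: "j \<in> J" and x: "x \<in> X"
    \<comment> \<open>The expansions at the two ends of \<open>x\<close> are subtracted; the root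
      terms cancel because both ends have the same root.\<close>
    have "(\<Sum>c\<in>C. (\<Sum>i\<in>J. w c i * H i x) * H j c)
        = (\<Sum>c\<in>C. w c (hd x) * (of_bool (hd c = j) - of_bool (tl c = j)))
          - (\<Sum>c\<in>C. w c (tl x) * (of_bool (hd c = j) - of_bool (tl c = j)))"
      unfolding sum_subtractf[symmetric]
    proof (rule sum.cong[OF refl])
      fix c assume "c \<in> C"
      then show "(\<Sum>i\<in>J. w c i * H i x) * H j c =
          w c (hd x) * (of_bool (hd c = j) - of_bool (tl c = j))
          - w c (tl x) * (of_bool (hd c = j) - of_bool (tl c = j))"
        using w[of x c] x HM[OF j, of c] C X by (auto simp only: left_diff_distrib subset_iff)
    qed
    also have "\<dots> = H j x"
      unfolding span[symmetric] using rt[OF x] HM[OF j, of x] x X by auto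
    finally show "H j x = (\<Sum>c\<in>C. (\<Sum>i\<in>J. w c i * H i x) * H j c)" ..
  qed
  then show ?thesis by blast
qed

section \<open>Cycle-edge matrices\<close>

text \<open>The rational vertex-edge matrix with rows indexed by the vertices; its kernel is the
  cycle space.\<close>

definition incidence :: "('v, 'e) pre_digraph \<Rightarrow> 'v \<Rightarrow> 'e \<Rightarrow> rat" where
  "incidence D v e = of_bool (head D e = v) - of_bool (tail D e = v)"

lemma both_ways_simps [simp]:
  "verts (both_ways D) = verts D" "arcs (both_ways D) = arcs D \<times> UNIV"
  "tail (both_ways D) (e, b) = (if b then tail D e else head D e)"
  "head (both_ways D) (e, b) = (if b then head D e else tail D e)"
  by (simp_all add: both_ways_def)

lemma (in wf_digraph) wf_both_ways: "wf_digraph (both_ways G)"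
  by unfold_locales auto

text \<open>Telescoping along the walk leaves only its two ends.\<close>

lemma (in pre_digraph) cas_sum_list:
  "cas u p v \<Longrightarrow> (\<Sum>a\<leftarrow>p. of_bool (head G a = x) - of_bool (tail G a = x))
     = (of_bool (v = x) - of_bool (u = x) :: rat)"
  by (induction p arbitrary: u) auto

text \<open>No edge is used in both directions, so the two indicators in \<open>cycle_vector\<close>
  never cancel.\<close>

lemma cycle_vector_eq_0_iff: "distinct (map fst p) \<Longrightarrow> cycle_vector p e = 0 \<longleftrightarrow> e \<notin> fst ` set p"
  and cycle_vector_square: "distinct (map fst p) \<Longrightarrow> e \<in> fst ` set p \<Longrightarrow> cycle_vector p e * cycle_vector p e = 1"
proof -
  assume d: "distinct (map fst p)"
  then have "\<not> ((e, True) \<in> set p \<and> (e, False) \<in> set p)"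
    using inj_onD[of fst "set p" "(e, True)" "(e, False)"] by (auto simp: distinct_map)
  moreover have "e \<in> fst ` set p \<longleftrightarrow> (e, True) \<in> set p \<or> (e, False) \<in> set p"
    by (simp add: image_iff Bex_def ex_bool_eq)
  ultimately show "cycle_vector p e = 0 \<longleftrightarrow> e \<notin> fst ` set p"
    "e \<in> fst ` set p \<Longrightarrow> cycle_vector p e * cycle_vector p e = 1"
    by (auto simp: cycle_vector_def)
qed

text \<open>The sum over edges is regrouped along the closed walk, where it telescopes to zero; each
  edge is used once, with the sign of its direction.\<close>

lemma traversed_cycle_incidence:
  assumes p: "traversed_cycle D p" and E: "finite (arcs D)"
  shows "(\<Sum>e\<in>arcs D. of_int (cycle_vector p e) * incidence D x e) = 0"
proof -
  let ?B = "both_ways D"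
  from p obtain u where u: "pre_digraph.awalk ?B u p u" and d: "distinct (map fst p)"
    by (auto simp: traversed_cycle_def pre_digraph.cycle_def)
  have p': "set p \<subseteq> arcs D \<times> UNIV" and cas: "pre_digraph.cas ?B u p u"
    using u by (auto simp: pre_digraph.awalk_def)
  have inj: "inj_on fst (set p)" using d by (simp add: distinct_map)
  have "(\<Sum>e\<in>arcs D. of_int (cycle_vector p e) * incidence D x e)
      = (\<Sum>e\<in>fst ` set p. of_int (cycle_vector p e) * incidence D x e)"
    using p' E cycle_vector_eq_0_iff[OF d] by (intro sum.mono_neutral_right) auto
  also have "\<dots> = (\<Sum>a\<in>set p. of_int (cycle_vector p (fst a)) * incidence D x (fst a))"
    by (simp add: sum.reindex[OF inj])
  also have "\<dots> = (\<Sum>a\<in>set p. of_bool (head ?B a = x) - of_bool (tail ?B a = x))"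
  proof (rule sum.cong[OF refl])
    fix a assume a: "a \<in> set p"
    obtain e b where e: "a = (e, b)" by force
    have "(e, \<not> b) \<notin> set p" using inj_onD[OF inj, of "(e, b)" "(e, \<not> b)"] a e by auto
    then have "cycle_vector p e = (if b then 1 else -1)"
      using a e by (cases b) (auto simp: cycle_vector_def)
    then show "of_int (cycle_vector p (fst a)) * incidence D x (fst a)
        = of_bool (head ?B a = x) - of_bool (tail ?B a = x)"
      by (simp add: e incidence_def)
  qed
  also have "\<dots> = (\<Sum>a\<leftarrow>p. of_bool (head ?B a = x) - of_bool (tail ?B a = x))"
    using d by (intro sum_list_distinct_conv_sum_set[symmetric]) (simp add: distinct_map)
  also have "\<dots> = 0" using pre_digraph.cas_sum_list[OF cas, of x] by simp
  finally show ?thesis .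
qed

text \<open>
  Orient the support of a circulation such that all values become positive. Then every vertex
  that is entered can be left again, so that a walk never ends and runs into a cycle.
\<close>
lemma circulation_cycle:
  assumes D: "fin_digraph D" and z: "\<And>x. x \<in> verts D \<Longrightarrow> (\<Sum>e\<in>arcs D. z e * incidence D x e) = 0"
    and e0: "e0 \<in> arcs D" "z e0 \<noteq> 0"
  shows "\<exists>p. traversed_cycle D p \<and> fst ` set p \<subseteq> {e \<in> arcs D. z e \<noteq> 0}"
proof -
  interpret fin_digraph D by fact
  let ?B = "both_ways D"
  define S where "S = {e \<in> arcs D. z e \<noteq> 0}"
  define A where "A = (\<lambda>e. (e, z e > 0)) ` S"
  define P where "P = ?B\<lparr>arcs := A\<rparr>"
  have finA: "finite A" by (simp add: A_def S_def)
  have AB: "A \<subseteq> arcs ?B" by (auto simp: A_def S_def)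
  have P_simps [simp]: "verts P = verts D" "arcs P = A" "tail P = tail ?B" "head P = head ?B"
    by (simp_all add: P_def)
  interpret B: wf_digraph ?B by (rule wf_both_ways)
  interpret P: wf_digraph P
    using AB B.tail_in_verts B.head_in_verts by unfold_locales auto
  \<comment> \<open>If no arc of \<open>A\<close> left \<open>x\<close>, all edges of the support
    would contribute nonnegatively to the sum at \<open>x\<close>, and the arriving edge
    \<open>e\<close> positively.\<close>
  have ex: "\<exists>a'\<in>A. tail ?B a' = head ?B a" if a: "a \<in> A" for a
  proof (rule ccontr)
    assume no: "\<not> ?thesis"
    define x where "x = head ?B a"
    have x: "x \<in> verts D" using AB a B.head_in_verts by (auto simp: x_def)
    obtain e where e: "e \<in> S" "a = (e, z e > 0)" using a by (auto simp: A_def)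
    have nonneg: "z e' * incidence D x e' \<ge> 0" "e' = e \<Longrightarrow> z e' * incidence D x e' > 0"
      if "e' \<in> S" for e'
    proof -
      have "z e' \<noteq> 0" using that by (simp add: S_def)
      have *: "tail ?B (e', z e' > 0) \<noteq> x" using no that by (auto simp: A_def x_def)
      show "z e' * incidence D x e' \<ge> 0"
        using * \<open>z e' \<noteq> 0\<close> by (auto simp: incidence_def not_less split: if_splits)
      show "z e' * incidence D x e' > 0" if "e' = e"
        using * \<open>z e' \<noteq> 0\<close> e that by (auto simp: incidence_def not_less x_def split: if_splits)
    qed
    have "0 = (\<Sum>e\<in>S. z e * incidence D x e)"
    proof -
      have "(\<Sum>e\<in>S. z e * incidence D x e) = (\<Sum>e\<in>arcs D. z e * incidence D x e)"
        unfolding S_def by (intro sum.mono_neutral_left) auto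
      then show ?thesis using z[OF x] by simp
    qed
    also have "\<dots> > 0"
      using e nonneg finA by (intro sum_pos2[of _ e]) (auto simp: S_def)
    finally show False by simp
  qed
  obtain nxt where nxt: "\<And>a. a \<in> A \<Longrightarrow> nxt a \<in> A \<and> tail ?B (nxt a) = head ?B a"
    using bchoice[of A "\<lambda>a a'. a' \<in> A \<and> tail ?B a' = head ?B a"] ex by blast
  \<comment> \<open>An infinite walk in the finite set \<open>A\<close>; it repeats an arc and so
    contains a closed walk.\<close>
  define s where "s i = (nxt ^^ i) (e0, z e0 > 0)" for i
  have s: "s i \<in> A" for i
    by (induction i) (use e0 nxt in \<open>auto simp: s_def A_def S_def\<close>)
  have s_Suc: "tail ?B (s (Suc i)) = head ?B (s i)" for i
    using nxt[OF s[of i]] by (simp add: s_def)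
  have walk: "P.awalk (tail ?B (s i)) (map s [i..<i + n]) (tail ?B (s (i + n)))" for i n
  proof (induction n arbitrary: i)
    case 0
    show ?case using P.tail_in_verts s by (auto simp: P.awalk_Nil_iff)
  next
    case (Suc n)
    have "[i..<i + Suc n] = i # [Suc i..<Suc i + n]" by (simp add: upt_conv_Cons)
    then show ?case using Suc[of "Suc i"] s s_Suc by (simp add: P.awalk_Cons_iff)
  qed
  have "\<not> inj s"
  proof
    assume "inj s"
    moreover have "finite (range s)" using finite_subset[OF _ finA, of "range s"] s by blast
    ultimately show False using finite_imageD[of s UNIV] by simp
  qed
  then obtain i j where ij: "i < j" "s i = s j"
    by (metis injI linorder_neqE_nat)
  have "P.awalk (tail ?B (s i)) (map s [i..<j]) (tail ?B (s i))"
    using walk[of i "j - i"] ij by simp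
  then have "P.closed_w (map s [i..<j])" using ij by (auto simp: P.closed_w_def)
  then obtain p where p: "P.cycle p" using P.closed_w_imp_cycle by blast
  have "subgraph P ?B"
    using AB P.wf_digraph B.wf_digraph by (auto simp: subgraph_def compatible_def)
  from B.subgraph_cycle[OF this p] have cyc: "B.cycle p" .
  have pA: "set p \<subseteq> A" and "distinct p"
    using p by (auto simp: P.cycle_conv P.awalk_def)
  \<comment> \<open>\<open>A\<close> contains each edge in one direction only, so a cycle in
    \<open>P\<close> cannot go back and forth along an edge.\<close>
  moreover have "inj_on fst A" by (auto simp: A_def inj_on_def)
  ultimately have "distinct (map fst p)" by (simp add: distinct_map inj_on_subset)
  then show ?thesis
    using cyc pA by (intro exI[of _ p]) (auto simp: traversed_cycle_def A_def S_def)
qed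

text \<open>
  The rows of a cycle-edge matrix contain, up to sign, all fundamental circuits of a spanning
  forest \<open>F\<close>. If \<open>F\<close> extends a spanning forest of the complement of \<open>X\<close>, then the
  circuits of the edges in \<open>X - F\<close> form a basis of the rows restricted to \<open>X\<close>.
\<close>
lemma cycle_edge_col_basis:
  assumes H: "cycle_edge_matrix D J E H" and J: "finite J" and X: "X \<subseteq> E"
  shows "\<exists>C w. col_basis J H X C w"
proof -
  from H obtain cyc where D: "fin_digraph D" "arcs D = E"
    and cyc: "\<And>i. i \<in> J \<Longrightarrow> traversed_cycle D (cyc i)"
    and bij: "bij_betw (\<lambda>i. fst ` set (cyc i)) J {fst ` set p |p. traversed_cycle D p}"
    and H': "\<And>i e. i \<in> J \<Longrightarrow> e \<in> E \<Longrightarrow> H i e = cycle_vector (cyc i) e"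
    unfolding cycle_edge_matrix_def by blast
  interpret fin_digraph D by fact
  have E: "finite E" using D(2) finite_arcs by simp
  let ?V = "verts D" and ?N = "incidence D"
  have fB: "finite (E - X)" using E by simp
  obtain F0 w0 where F0: "col_basis ?V ?N (E - X) F0 w0"
    using col_basis_exists[OF finite_verts fB] by blast
  from col_basis_extend[OF finite_verts E _ F0] obtain F w
    where F: "col_basis ?V ?N E F w" "F0 \<subseteq> F" "F \<subseteq> F0 \<union> (E - (E - X))" by blast
  have FE: "F \<subseteq> E" "finite F" using col_basis_subset[OF F(1)] E finite_subset by auto
  have F0B: "F0 \<subseteq> E - X" by (rule col_basis_subset[OF F0])
  define circ where "circ z \<longleftrightarrow> (\<forall>x\<in>?V. (\<Sum>e\<in>E. z e * ?N x e) = 0)" for z :: "'b \<Rightarrow> rat"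
  \<comment> \<open>The columns of the forest \<open>F\<close> are independent, so a circulation is
    determined by its values off \<open>F\<close>.\<close>
  have circ_F: "z e = 0" if "circ z" "\<And>e. e \<in> E - F \<Longrightarrow> z e = 0" "e \<in> E" for z e
  proof (cases "e \<in> F")
    case True
    have "(\<Sum>e\<in>F. z e * ?N x e) = (\<Sum>e\<in>E. z e * ?N x e)" for x
      using FE E that(2) by (intro sum.mono_neutral_left) auto
    then show ?thesis
      using that(1) col_basis_indep[OF F(1) E] True unfolding indep_cols_def circ_def by metis
  qed (use that in auto)
  have circ_diff: "circ (\<lambda>e. z e - a * y e)" if "circ z" "circ y" for z y a
    using that by (simp add: circ_def left_diff_distrib sum_subtractf mult.assoc flip: sum_distrib_left)
  have circ_cycle: "circ (\<lambda>e. of_int (cycle_vector p e))" if "traversed_cycle D p" for p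
    using traversed_cycle_incidence[OF that] D E by (simp add: circ_def)
  define v where "v f e = (\<Sum>i\<in>?V. w f i * ?N i e)" for f e
  \<comment> \<open>The fundamental circulation of \<open>c\<close>: column \<open>c\<close> minus
    its expansion in the forest columns.\<close>
  define fund where "fund c e = (if e = c then 1 else if e \<in> F then - v e c else 0)" for c e
  have circ_fund: "circ (fund c)" if c: "c \<in> E - F" for c
    unfolding circ_def
  proof
    fix x assume x: "x \<in> ?V"
    have "(\<Sum>e\<in>E. fund c e * ?N x e) = (\<Sum>e\<in>insert c F. fund c e * ?N x e)"
      using FE E c by (intro sum.mono_neutral_right) (auto simp: fund_def)
    also have "\<dots> = ?N x c + (\<Sum>e\<in>F. - (v e c * ?N x e))"
      using FE c by (simp add: fund_def) (intro sum.cong, auto)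
    also have "\<dots> = 0"
      using col_basis_span[OF F(1) x, of c] c by (simp add: v_def sum_negf)
    finally show "(\<Sum>e\<in>E. fund c e * ?N x e) = 0" .
  qed
  \<comment> \<open>The support of \<open>fund c\<close> contains a cycle, and some row has the same
    edge set. Off \<open>F\<close> it can only use \<open>c\<close>, and it does use
    \<open>c\<close> by \<open>circ_F\<close>; after adjusting the sign it agrees with
    \<open>fund c\<close> off \<open>F\<close>, hence everywhere.\<close>
  have ex: "\<exists>i\<in>J. \<exists>a. \<forall>e\<in>E. of_int (a * H i e) = fund c e" if c: "c \<in> E - F" for c
  proof -
    have "\<exists>p. traversed_cycle D p \<and> fst ` set p \<subseteq> {e \<in> arcs D. fund c e \<noteq> 0}"
      using circ_fund[OF c] c D
      by (intro circulation_cycle[where ?e0.0 = c]) (auto simp: circ_def fund_def)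
    then obtain p where p: "traversed_cycle D p" "fst ` set p \<subseteq> {e \<in> E. fund c e \<noteq> 0}"
      using D by auto
    then obtain i where i: "i \<in> J" "fst ` set (cyc i) = fst ` set p"
      using bij unfolding bij_betw_def by (smt (verit) imageE mem_Collect_eq)
    define y where "y e = cycle_vector (cyc i) e" for e
    have dist: "distinct (map fst (cyc i))" and ne: "cyc i \<noteq> []"
      using cyc[OF i(1)] by (auto simp: traversed_cycle_def pre_digraph.cycle_def)
    have circ_y: "circ (\<lambda>e. of_int (y e))" using circ_cycle[OF cyc[OF i(1)]] by (simp add: y_def)
    have y0: "y e = 0" if "e \<in> E - F" "e \<noteq> c" for e
      using that p(2) i(2) cycle_vector_eq_0_iff[OF dist, of e] by (auto simp: y_def fund_def)
    obtain e1 where e1: "e1 \<in> fst ` set (cyc i)" using ne by (cases "cyc i") auto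
    have "c \<in> fst ` set (cyc i)"
    proof (rule ccontr)
      assume "\<not> ?thesis"
      then have yc0: "y c = 0" using cycle_vector_eq_0_iff[OF dist] by (simp add: y_def)
      have "of_int (y e1) = (0 :: rat)"
      proof (rule circ_F[OF circ_y])
        fix e assume "e \<in> E - F"
        then show "of_int (y e) = (0 :: rat)" using y0[of e] yc0 by (cases "e = c") simp_all
      next
        show "e1 \<in> E" using e1 i(2) p(2) by blast
      qed
      then show False using e1 cycle_vector_eq_0_iff[OF dist, of e1] by (simp add: y_def)
    qed
    then have yc: "y c * y c = 1" using cycle_vector_square[OF dist] by (simp add: y_def)
    have "fund c e - of_int (y c) * of_int (y e) = 0" if "e \<in> E" for e
    proof (rule circ_F[OF circ_diff[OF circ_fund[OF c] circ_y] _ that])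
      fix e assume e: "e \<in> E - F"
      show "fund c e - of_int (y c) * of_int (y e) = 0"
      proof (cases "e = c")
        case True
        have "of_int (y c) * of_int (y c) = (1 :: rat)" using yc by (metis of_int_1 of_int_mult)
        then show ?thesis using True by (simp add: fund_def)
      qed (use e y0 in \<open>auto simp: fund_def\<close>)
    qed
    then have "\<forall>e\<in>E. of_int (y c * H i e) = fund c e" using H'[OF i(1)] by (simp add: y_def)
    then show ?thesis using i(1) by blast
  qed
  then obtain ix a where ix: "\<And>c. c \<in> E - F \<Longrightarrow> ix c \<in> J"
    and fund: "\<And>c e. c \<in> E - F \<Longrightarrow> e \<in> E \<Longrightarrow> of_int (a c * H (ix c) e) = fund c e"
    by metis
  \<comment> \<open>The dual vector of \<open>c\<close> picks the single row \<open>ix c\<close>,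
    with its sign \<open>a c\<close>.\<close>
  define u where "u c j = (if j = ix c then a c else 0)" for c j
  have u: "of_int (\<Sum>j\<in>J. u c j * H j x) = fund c x" if "c \<in> E - F" "x \<in> E" for c x
  proof -
    have "(\<Sum>j\<in>J. u c j * H j x) = (\<Sum>j\<in>J. if j = ix c then a c * H j x else 0)"
      by (intro sum.cong) (auto simp: u_def)
    also have "\<dots> = a c * H (ix c) x" using J ix that by simp
    finally show ?thesis using fund[OF that] by simp
  qed
  \<comment> \<open>An edge \<open>c\<close> outside \<open>X\<close> is already spanned by
    \<open>F0\<close>, so its fundamental circuit stays outside \<open>X\<close>.\<close>
  have fund_0: "fund c x = 0" if "c \<in> (E - X) - F" "x \<in> X" for c x
  proof -
    have "v x c = 0" if x: "x \<in> F"
    proof -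
      define v0 where "v0 f = (\<Sum>i\<in>?V. w0 f i * ?N i c)" for f
      have "v x c = (\<Sum>i\<in>?V. w x i * (\<Sum>f\<in>F0. v0 f * ?N i f))"
        unfolding v_def v0_def using col_basis_span[OF F0] \<open>c \<in> (E - X) - F\<close>
        by (intro sum.cong) auto
      also have "\<dots> = (\<Sum>f\<in>F0. v0 f * (\<Sum>i\<in>?V. w x i * ?N i f))"
        unfolding sum_distrib_left by (subst sum.swap) (simp add: mult_ac)
      also have "\<dots> = 0"
      proof (rule sum.neutral, rule ballI)
        fix f assume f: "f \<in> F0"
        then have "f \<in> F" "x \<noteq> f" using F F0B \<open>x \<in> X\<close> by auto
        then show "v0 f * (\<Sum>i\<in>?V. w x i * ?N i f) = 0"
          using col_basis_dual[OF F(1) x, of f] by simp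
      qed
      finally show ?thesis .
    qed
    then show ?thesis using that by (auto simp: fund_def)
  qed
  have "col_basis J H X (X - F) u"
  proof (rule col_basisI)
    fix c c' assume c: "c \<in> X - F" "c' \<in> X - F"
    have "(of_int (\<Sum>j\<in>J. u c j * H j c') :: rat) = of_bool (c = c')"
      using c X by (subst u) (auto simp: fund_def)
    then show "(\<Sum>j\<in>J. u c j * H j c') = of_bool (c = c')"
      by (metis of_int_of_bool of_int_eq_iff)
  next
    fix j x assume j: "j \<in> J" and x: "x \<in> X"
    \<comment> \<open>Row \<open>j\<close> minus its expansion in fundamental circulations is a
      circulation that vanishes off \<open>F\<close>, hence zero.\<close>
    let ?y = "\<lambda>e. of_int (H j e) - (\<Sum>c\<in>E - F. of_int (H j c) * fund c e)"
    have circ_y: "circ ?y"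
    proof -
      have 1: "circ (\<lambda>e. of_int (H j e))"
        using circ_cycle[OF cyc[OF j]] H'[OF j] by (simp add: circ_def)
      have "circ (\<lambda>e. of_int (H j e) - (\<Sum>c\<in>S. of_int (H j c) * fund c e))" if "finite S" "S \<subseteq> E - F" for S
        using that
      proof (induction S rule: finite_induct)
        case empty
        then show ?case using 1 by simp
      next
        case (insert c S)
        then show ?case
          using circ_diff[OF insert.IH circ_fund[of c], of "of_int (H j c)"]
          by (simp add: algebra_simps)
      qed
      then show ?thesis using E by blast
    qed
    have y: "?y e = 0" if e: "e \<in> E - F" for e
    proof -
      have "(\<Sum>c\<in>E - F. of_int (H j c) * fund c e) = (\<Sum>c\<in>E - F. if c = e then of_int (H j c) else 0)"
        using e by (intro sum.cong) (auto simp: fund_def)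
      then show ?thesis using E e by simp
    qed
    have "?y x = 0" by (rule circ_F[OF circ_y y]) (use x X in auto)
    then have "of_int (H j x) = (\<Sum>c\<in>E - F. of_int (H j c) * fund c x)" by simp
    also have "\<dots> = (\<Sum>c\<in>X - F. of_int (H j c) * fund c x)"
      using E X x fund_0 by (intro sum.mono_neutral_right) auto
    also have "\<dots> = (\<Sum>c\<in>X - F. of_int (\<Sum>i\<in>J. u c i * H i x) * of_int (H j c))"
    proof (rule sum.cong[OF refl])
      fix c assume c: "c \<in> X - F"
      then show "of_int (H j c) * fund c x = of_int (\<Sum>i\<in>J. u c i * H i x) * of_int (H j c)"
        using x X by (subst u) auto
    qed
    finally have "(of_int (H j x) :: rat) = of_int (\<Sum>c\<in>X - F. (\<Sum>i\<in>J. u c i * H i x) * H j c)"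
      by simp
    then show "H j x = (\<Sum>c\<in>X - F. (\<Sum>i\<in>J. u c i * H i x) * H j c)"
      by (metis of_int_eq_iff)
  qed auto
  then show ?thesis by blast
qed

lemma regular_matrix_col_basis:
  assumes "regular_matrix D J E H" "finite J" "X \<subseteq> E" "finite X"
  shows "\<exists>C w. col_basis J H X C w"
  using assms vertex_edge_col_basis[of D J E H X] cycle_edge_col_basis[of D J E H X]
    totally_unimodular_col_basis[of J E H X]
  unfolding regular_matrix_def by blast

section \<open>Counting flows\<close>

lemma int_scale_Suc: "int_scale (n + 1) a = int_scale n a + a"
proof (cases "n \<ge> 0")
  case True
  then have "nat (n + 1) = Suc (nat n)" "nat (- n) = 0" "nat (- n - 1) = 0" by auto
  then show ?thesis by (simp add: int_scale_def)
next
  case False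
  then have "nat (- n) = Suc (nat (- n - 1))" "nat n = 0" "nat (n + 1) = 0" by auto
  then show ?thesis by (simp add: int_scale_def)
qed

text \<open>Makes every Abelian group an integer module, so that \<open>card_kernel\<close> applies
  to integer matrices. The laws for sums and products of integers follow by induction in both
  directions.\<close>

lemma module_int_scale: "Modules.module int_scale"
proof
  fix m n :: int and a b :: 'a
  have 0: "int_scale 0 c = 0" for c :: 'a by (simp add: int_scale_def)
  have 1: "int_scale 1 c = c" for c :: 'a by (simp add: int_scale_def)
  have pred: "int_scale (k - 1) c = int_scale k c - c" for k and c :: 'a
    using int_scale_Suc[of "k - 1" c] by simp
  have add: "int_scale (m + n) c = int_scale m c + int_scale n c" for m n and c :: 'a
  proof (induction n rule: int_induct[where k = 0])
    case (step1 i)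
    then show ?case using int_scale_Suc[of "m + i" c] int_scale_Suc[of i c] by (simp add: add.assoc)
  next
    case (step2 i)
    then show ?case by (simp add: pred add_diff_eq)
  qed (simp add: 0)
  then show "int_scale (m + n) a = int_scale m a + int_scale n a" .
  show "int_scale m (a + b) = int_scale m a + int_scale m b"
    by (simp add: int_scale_def sum.distrib)
  show "int_scale m (int_scale n a) = int_scale (m * n) a"
  proof (induction m rule: int_induct[where k = 0])
    case (step1 i)
    then show ?case by (simp add: 1 add distrib_right)
  next
    case (step2 i)
    have "int_scale (i * n) a = int_scale ((i - 1) * n) a + int_scale n a"
      unfolding add[symmetric] by (simp add: algebra_simps)
    then show ?case using step2 by (simp add: pred)
  qed (simp add: 0)
  show "int_scale 1 a = a" by (rule 1)
qed

lemma module_vector_scalar_mult: "Modules.module ((*s) :: 'k::field \<Rightarrow> 'k ^ 'd \<Rightarrow> 'k ^ 'd)"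
  by standard (simp_all add: Finite_Cartesian_Product.vec_eq_iff vector_scalar_mult_def algebra_simps)

lemma col_rk_le_card: "finite B \<Longrightarrow> col_rk J H B \<le> card B"
  unfolding col_rk_def
  by (intro Max.boundedI) (auto simp: indep_cols_def card_mono)

text \<open>Restriction to \<open>E - B\<close> and extension by zero identify these flows with the
  kernel of \<open>H\<close> on the columns off \<open>B\<close>.\<close>

lemma card_flows_vanishing:
  fixes H :: "'j \<Rightarrow> 'e \<Rightarrow> 'r::comm_ring_1"
    and smul :: "'r \<Rightarrow> 'a \<Rightarrow> 'a::{ab_group_add,finite}"
  assumes m: "Modules.module smul" and b: "col_basis J H (E - B) C w" and E: "finite E" "B \<subseteq> E"
  shows "card {h \<in> E \<rightarrow>\<^sub>E UNIV. is_flow smul E J H h \<and> (\<forall>e\<in>B. h e = 0)} = CARD('a) ^ (card (E - B) - card C)"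
proof -
  interpret Modules.module smul by fact
  have sum: "(\<Sum>e\<in>E. smul (H j e) (h e)) = (\<Sum>e\<in>E - B. smul (H j e) (h e))"
    if "\<forall>e\<in>B. h e = 0" for j h
    using E that by (intro sum.mono_neutral_right) auto
  let ?K = "{h \<in> E - B \<rightarrow>\<^sub>E UNIV. \<forall>j\<in>J. (\<Sum>e\<in>E - B. smul (H j e) (h e)) = 0}"
  have "bij_betw (\<lambda>h. restrict h (E - B))
      {h \<in> E \<rightarrow>\<^sub>E UNIV. is_flow smul E J H h \<and> (\<forall>e\<in>B. h e = 0)} ?K"
  proof (rule bij_betw_byWitness[where f' = "\<lambda>h e. if e \<in> B then 0 else h e"], goal_cases)
    case 1
    show ?case using E(2) by (intro ballI ext) (auto simp: PiE_def extensional_def restrict_def)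
  next
    case 2
    show ?case by (intro ballI ext) (auto simp: PiE_def extensional_def restrict_def)
  next
    case 3
    show ?case by (auto simp: is_flow_def sum)
  next
    case 4
    show ?case
    proof (intro image_subsetI CollectI conjI)
      fix h assume h: "h \<in> ?K"
      let ?h = "\<lambda>e. if e \<in> B then 0 else h e"
      show "?h \<in> E \<rightarrow>\<^sub>E UNIV" using h E by (auto simp: PiE_def extensional_def)
      have "(\<Sum>e\<in>E. smul (H j e) (?h e)) = (\<Sum>e\<in>E - B. smul (H j e) (h e))" for j
        by (subst sum) (auto intro!: sum.cong)
      then show "is_flow smul E J H ?h" using h by (simp add: is_flow_def)
    qed auto
  qed
  then show ?thesis using card_kernel[OF m b] E by (simp add: bij_betw_same_card)
qed

section \<open>Summing powers of a root of unity over pairs of functions\<close>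

text \<open>
  The left side is the contribution of one edge on which the difference of the two functions
  takes the value \<open>b\<close>. The point of the weights \<open>1\<close> and \<open>\<tau> - 1\<close> is that \<open>x * y = \<omega> ^ \<tau> = -1\<close>.
\<close>
lemma edge_weight_sum:
  fixes x y :: complex and b :: "'a::{ab_group_add,finite}"
  assumes "x * y = -1"
  shows "(\<Sum>a\<in>UNIV. (if b + a \<noteq> 0 then x else 1) * (if a \<noteq> 0 then y else 1))
     = (if b = 0 then - (x + y) else 0) + (x + y + 2 - of_nat CARD('a))"
proof (cases "b = 0")
  case True
  \<comment> \<open>Every nonzero \<open>a\<close> contributes \<open>x * y = -1\<close>, and
    \<open>a = 0\<close> contributes \<open>1 = 2 - 1\<close>.\<close>
  have "(\<Sum>a\<in>UNIV. (if b + a \<noteq> 0 then x else 1) * (if a \<noteq> 0 then y else 1))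
      = (\<Sum>a\<in>(UNIV :: 'a set). (if a = 0 then 2 else 0) - 1)"
    using assms True by (intro sum.cong) auto
  also have "\<dots> = 2 - of_nat CARD('a)" unfolding sum_subtractf by simp
  finally show ?thesis using True by simp
next
  case False
  \<comment> \<open>Here \<open>a = 0\<close> contributes \<open>x\<close>, the different element
    \<open>a = - b\<close> contributes \<open>y\<close>, and all others contribute -1.\<close>
  have "(\<Sum>a\<in>UNIV. (if b + a \<noteq> 0 then x else 1) * (if a \<noteq> 0 then y else 1))
      = (\<Sum>a\<in>(UNIV :: 'a set). (if a = 0 then x + 1 else 0) + (if a = - b then y + 1 else 0) - 1)"
    using assms False by (intro sum.cong) (auto simp: add_eq_0_iff)
  also have "\<dots> = x + y + 2 - of_nat CARD('a)" unfolding sum_subtractf sum.distrib by simp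
  finally show ?thesis using False by simp
qed

text \<open>As \<open>\<omega> ^ m = 1\<close>, each pair in a residue class has the weight of the
  class, and for a fixed difference \<open>h\<close> this weight factors over the edges. The
  hypothesis \<open>restrict\<close> is there because \<open>f - g\<close> is not extensional: off
  \<open>E\<close> it is 0.\<close>

lemma sum_flow_pairs:
  fixes flow :: "('e \<Rightarrow> 'a::{ab_group_add,finite}) \<Rightarrow> bool" and \<omega> :: complex
  assumes E: "finite E" and m: "\<omega> ^ m = 1" "m > 0"
    and restrict: "\<And>h. flow (restrict h E) \<longleftrightarrow> flow h"
  shows "(\<Sum>k<m. \<omega> ^ k * of_nat (card (flow_pairs E flow a b k m)))
    = (\<Sum>h\<in>{h \<in> E \<rightarrow>\<^sub>E UNIV. flow h}.
        \<Prod>e\<in>E. \<Sum>z\<in>UNIV. (if h e + z \<noteq> 0 then \<omega> ^ a else 1) * (if z \<noteq> 0 then \<omega> ^ b else 1))"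
proof -
  let ?A = "E \<rightarrow>\<^sub>E (UNIV :: 'a set)"
  define P where "P = {(f, g). f \<in> ?A \<and> g \<in> ?A \<and> flow (\<lambda>e. f e - g e)}"
  define N where "N = (\<lambda>(f, g). a * card (supp_on E (f :: 'e \<Rightarrow> 'a)) + b * card (supp_on E (g :: 'e \<Rightarrow> 'a)))"
  have finA: "finite ?A" using E by (simp add: finite_PiE)
  have finP: "finite P"
    by (rule finite_subset[of _ "?A \<times> ?A"]) (use finA in \<open>auto simp: P_def\<close>)
  have pow: "\<omega> ^ (n mod m) = \<omega> ^ n" for n
  proof -
    have "\<omega> ^ n = \<omega> ^ (m * (n div m) + n mod m)" by simp
    also have "\<dots> = (\<omega> ^ m) ^ (n div m) * \<omega> ^ (n mod m)" by (simp only: power_add power_mult)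
    finally show ?thesis using m by simp
  qed
  have supp: "c ^ card (supp_on E f) = (\<Prod>e\<in>E. if f e \<noteq> 0 then c else 1)" for c :: complex and f :: "'e \<Rightarrow> 'a"
  proof -
    have "(\<Prod>e\<in>E. if f e \<noteq> 0 then c else 1) = (\<Prod>e\<in>supp_on E f. c)"
      using E by (intro prod.mono_neutral_cong_right) (auto simp: supp_on_def)
    then show ?thesis by simp
  qed
  have "(\<Sum>k<m. \<omega> ^ k * of_nat (card (flow_pairs E flow a b k m)))
      = (\<Sum>k<m. \<Sum>p\<in>{p\<in>P. N p mod m = k}. \<omega> ^ N p)"
  proof (rule sum.cong[OF refl])
    fix k assume k: "k \<in> {..<m}"
    then have "flow_pairs E flow a b k m = {p\<in>P. N p mod m = k}"
      by (auto simp: flow_pairs_def P_def N_def cong_def)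
    moreover have "(\<Sum>p\<in>{p\<in>P. N p mod m = k}. \<omega> ^ N p) = (\<Sum>p\<in>{p\<in>P. N p mod m = k}. \<omega> ^ k)"
      by (intro sum.cong) (auto simp: pow)
    ultimately show "\<omega> ^ k * of_nat (card (flow_pairs E flow a b k m))
        = (\<Sum>p\<in>{p\<in>P. N p mod m = k}. \<omega> ^ N p)" by (simp add: mult.commute)
  qed
  also have "\<dots> = (\<Sum>p\<in>P. \<omega> ^ N p)"
    using finP m(2) by (intro sum.group) auto
  \<comment> \<open>The substitution \<open>f = h + g\<close>, where sums and differences are cut
    back to \<open>E\<close> to stay extensional.\<close>
  also have "\<dots> = (\<Sum>(h, g)\<in>{h \<in> ?A. flow h} \<times> ?A. \<omega> ^ N (restrict (\<lambda>e. h e + g e) E, g))"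
  proof (rule sum.reindex_bij_witness[where
        j = "\<lambda>(f, g). (restrict (\<lambda>e. f e - g e) E, g)" and i = "\<lambda>(h, g). (restrict (\<lambda>e. h e + g e) E, g)"],
      goal_cases)
    case (1 p)
    then show ?case
      by (auto simp: P_def restrict_def PiE_def extensional_def fun_eq_iff)
  next
    case (2 p)
    then show ?case using restrict[of "\<lambda>e. fst p e - snd p e"] by (auto simp: P_def)
  next
    case (3 p)
    then show ?case
      by (auto simp: P_def restrict_def PiE_def extensional_def fun_eq_iff)
  next
    case (4 p)
    obtain h g where p: "p = (h, g)" by force
    have "flow (\<lambda>e. restrict (\<lambda>e. h e + g e) E e - g e) \<longleftrightarrow> flow (restrict (\<lambda>e. restrict (\<lambda>e. h e + g e) E e - g e) E)"
      by (rule restrict[symmetric])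
    also have "restrict (\<lambda>e. restrict (\<lambda>e. h e + g e) E e - g e) E = restrict h E"
      by (auto simp: restrict_def)
    finally have "flow (\<lambda>e. restrict (\<lambda>e. h e + g e) E e - g e)"
      using 4 p restrict[of h] by (simp del: restrict_apply)
    moreover have "restrict (\<lambda>e. h e + g e) E \<in> ?A" by simp
    ultimately show ?case using 4 p by (simp add: P_def del: restrict_apply)
  next
    case (5 p)
    obtain f g where p: "p = (f, g)" by force
    have "restrict (\<lambda>e. restrict (\<lambda>e. f e - g e) E e + g e) E = f"
      using 5 p by (auto simp: P_def restrict_def PiE_def extensional_def fun_eq_iff)
    then show ?case by (simp add: p)
  qed
  also have "\<dots> = (\<Sum>h\<in>{h \<in> ?A. flow h}. \<Sum>g\<in>?A. \<Prod>e\<in>E.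
      (if h e + g e \<noteq> 0 then \<omega> ^ a else 1) * (if g e \<noteq> 0 then \<omega> ^ b else 1))"
    unfolding sum.cartesian_product[symmetric]
  proof (intro sum.cong refl)
    fix h g :: "'e \<Rightarrow> 'a"
    have "(\<Prod>e\<in>E. if restrict (\<lambda>e. h e + g e) E e \<noteq> 0 then \<omega> ^ a else 1)
        = (\<Prod>e\<in>E. if h e + g e \<noteq> 0 then \<omega> ^ a else 1)"
      by (intro prod.cong) auto
    then show "\<omega> ^ N (restrict (\<lambda>e. h e + g e) E, g) = (\<Prod>e\<in>E.
      (if h e + g e \<noteq> 0 then \<omega> ^ a else 1) * (if g e \<noteq> 0 then \<omega> ^ b else 1))"
      by (simp only: N_def prod.case power_add power_mult supp prod.distrib)
  qed
  \<comment> \<open>With \<open>h\<close> fixed, the values of \<open>g\<close> on different edges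
    are independent, so the sum of products is a product of sums.\<close>
  also have "\<dots> = (\<Sum>h\<in>{h \<in> ?A. flow h}. \<Prod>e\<in>E. \<Sum>z\<in>UNIV.
      (if h e + z \<noteq> 0 then \<omega> ^ a else 1) * (if z \<noteq> 0 then \<omega> ^ b else 1))"
    by (intro sum.cong refl, subst prod_sum_PiE) (use E in auto)
  finally show ?thesis .
qed

text \<open>\<open>H\<close> defines the flows and \<open>H'\<close> carries the ranks over a field:
  \<open>H'\<close> is the rational version of an integer \<open>H\<close>, or \<open>H\<close>
  itself over a field. The hypothesis on \<open>H\<close> links them through the size of a
  basis.\<close>

lemma sum_flow_pairs_rank_poly:
  fixes G :: "'i \<Rightarrow> 'e \<Rightarrow> 'k::field" and H' :: "'j \<Rightarrow> 'e \<Rightarrow> 'k" and H :: "'j \<Rightarrow> 'e \<Rightarrow> 'r::comm_ring_1"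
    and smul :: "'r \<Rightarrow> 'a \<Rightarrow> 'a::{ab_group_add,finite}" and \<omega> S :: complex
  assumes fin: "finite I" "finite J" "finite E" and d: "orthogonally_dual E I G J H'"
    and m: "Modules.module smul"
    and H: "\<And>X. X \<subseteq> E \<Longrightarrow> \<exists>C w. col_basis J H X C w \<and> card C = col_rk J H' X"
    and \<omega>: "\<omega> ^ \<tau> = -1" "\<tau> \<ge> 1" and S: "S = \<omega> - inverse \<omega>" "S \<noteq> 0" "S + 2 - of_nat CARD('a) \<noteq> 0"
  shows "(\<Sum>k<2 * \<tau>. \<omega> ^ k * of_nat (card (flow_pairs E (is_flow smul E J H) 1 (\<tau> - 1) k (2 * \<tau>))))
    = (- S) ^ col_rk I G E * (S + 2 - of_nat CARD('a)) ^ (card E - col_rk I G E) *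
      rank_poly (col_rk I G) E (- of_nat CARD('a) * (S + 2 - of_nat CARD('a)) / S)
        (- S / (S + 2 - of_nat CARD('a)))"
proof -
  define q where "q = CARD('a)"
  define t where "t = S + 2 - of_nat q"
  have S0: "- S \<noteq> 0" and t0: "t \<noteq> 0" using S by (simp_all add: t_def q_def)
  let ?F = "{h \<in> E \<rightarrow>\<^sub>E (UNIV :: 'a set). is_flow smul E J H h}"
  have finF: "finite ?F" using fin by (simp add: finite_PiE)
  have \<omega>0: "\<omega> \<noteq> 0" using \<omega> by (metis one_neq_neg_one power_0_left zero_neq_neg_one)
  have y: "\<omega> * \<omega> ^ (\<tau> - 1) = -1" using \<omega> by (metis Suc_diff_le diff_Suc_1 One_nat_def power_Suc)
  then have y': "\<omega> ^ (\<tau> - 1) = - inverse \<omega>" using \<omega>0 by (simp add: field_simps)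
  have "\<omega> ^ (2 * \<tau>) = 1" using \<omega> by (simp add: mult.commute[of 2] power_mult)
  moreover have "is_flow smul E J H (restrict h E) \<longleftrightarrow> is_flow smul E J H h" for h
    by (simp add: is_flow_def)
  ultimately have "(\<Sum>k<2 * \<tau>. \<omega> ^ k * of_nat (card (flow_pairs E (is_flow smul E J H) 1 (\<tau> - 1) k (2 * \<tau>))))
      = (\<Sum>h\<in>?F. \<Prod>e\<in>E. \<Sum>z\<in>UNIV. (if h e + z \<noteq> 0 then \<omega> ^ 1 else 1) * (if z \<noteq> 0 then \<omega> ^ (\<tau> - 1) else 1))"
    using \<omega>(2) by (intro sum_flow_pairs[OF fin(3)]) auto
  also have "\<dots> = (\<Sum>h\<in>?F. \<Prod>e\<in>E. (if h e = 0 then - S else 0) + t)"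
  proof -
    have "\<omega> + \<omega> ^ (\<tau> - 1) = S" unfolding S(1) y' by simp
    then show ?thesis by (simp only: power_one_right edge_weight_sum[OF y] t_def q_def)
  qed
  also have "\<dots> = (\<Sum>h\<in>?F. \<Sum>B\<in>Pow E. of_bool (\<forall>e\<in>B. h e = 0) * ((- S) ^ card B * t ^ card (E - B)))"
  proof (rule sum.cong[OF refl])
    fix h
    have "(\<Prod>e\<in>B. if h e = 0 then - S else 0) = of_bool (\<forall>e\<in>B. h e = 0) * (- S) ^ card B"
      if "B \<subseteq> E" for B
    proof (cases "\<forall>e\<in>B. h e = 0")
      case False
      have "finite B" using that fin finite_subset by blast
      then show ?thesis using False by (auto simp: prod_zero_iff)
    qed simp
    then show "(\<Prod>e\<in>E. (if h e = 0 then - S else 0) + t)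
        = (\<Sum>B\<in>Pow E. of_bool (\<forall>e\<in>B. h e = 0) * ((- S) ^ card B * t ^ card (E - B)))"
      unfolding prod_add[OF fin(3)] by (intro sum.cong) (auto simp: mult.assoc)
  qed
  also have "\<dots> = (\<Sum>B\<in>Pow E. of_nat (card {h \<in> ?F. \<forall>e\<in>B. h e = 0}) * ((- S) ^ card B * t ^ card (E - B)))"
  proof (subst sum.swap, rule sum.cong[OF refl])
    fix B
    have "(\<Sum>h\<in>?F. of_bool (\<forall>e\<in>B. h e = 0)) = (of_nat (card {h \<in> ?F. \<forall>e\<in>B. h e = 0}) :: complex)"
      using finF by (simp add: of_bool_def sum.If_cases Int_def)
    then show "(\<Sum>h\<in>?F. of_bool (\<forall>e\<in>B. h e = 0) * ((- S) ^ card B * t ^ card (E - B)))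
        = of_nat (card {h \<in> ?F. \<forall>e\<in>B. h e = 0}) * ((- S) ^ card B * t ^ card (E - B))"
      by (simp add: sum_distrib_right[symmetric])
  qed
  also have "\<dots> = (\<Sum>B\<in>Pow E. (- S) ^ col_rk I G E * t ^ (card E - col_rk I G E) *
      ((- of_nat q * t / S) ^ (col_rk I G E - col_rk I G B) * (- S / t) ^ (card B - col_rk I G B)))"
  proof (rule sum.cong[OF refl])
    fix B assume "B \<in> Pow E"
    then have B: "B \<subseteq> E" "finite B" using fin finite_subset by auto
    obtain C w where C: "col_basis J H (E - B) C w" "card C = col_rk J H' (E - B)"
      using H[of "E - B"] by blast
    \<comment> \<open>Duality turns the dimension \<open>card (E - B) - card C\<close> of the flows
      vanishing on \<open>B\<close> into \<open>r - k\<close>, the exponent in the rank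
      polynomial.\<close>
    have dual: "card (E - B) + col_rk I G B = card C + col_rk I G E"
      using dual_col_rk[OF fin d B(1)] C by simp
    have le: "col_rk I G B \<le> card B" "card C \<le> card (E - B)" "col_rk I G E \<le> card E"
      using col_rk_le_card[OF B(2), of I G] col_rk_le_card[of "E - B" J H']
        col_rk_le_card[OF fin(3), of I G] fin C by auto
    have card: "card (E - B) = card E - card B" "card B \<le> card E"
      using B fin by (auto simp: card_Diff_subset card_mono)
    define r k b n where "r = col_rk I G E" and "k = col_rk I G B" and "b = card B" and "n = card E"
    have rk: "k \<le> r" "k \<le> b" "r \<le> n" "b \<le> n" "card (E - B) - card C = r - k"
      using dual le card by (auto simp: r_def k_def b_def n_def)
    have "{h \<in> ?F. \<forall>e\<in>B. h e = 0} = {h \<in> E \<rightarrow>\<^sub>E UNIV. is_flow smul E J H h \<and> (\<forall>e\<in>B. h e = 0)}"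
      by auto
    then have num: "card {h \<in> ?F. \<forall>e\<in>B. h e = 0} = q ^ (r - k)"
      using card_flows_vanishing[OF m C(1) fin(3) B(1)] rk(5) by (simp add: q_def)
    \<comment> \<open>Both exponents are \<open>r + b - k\<close>; the truncated differences are
      genuine because \<open>k\<close> is at most \<open>r\<close> and \<open>b\<close>.\<close>
    have pS: "(- S) ^ r * (- S) ^ (b - k) = (- S) ^ b * (- S) ^ (r - k)"
      unfolding power_add[symmetric] using rk by (intro arg_cong2[of _ _ _ _ power]) auto
    have pt: "t ^ (n - r) * t ^ (r - k) = t ^ (n - b) * t ^ (b - k)"
      unfolding power_add[symmetric] using rk by (intro arg_cong2[of _ _ _ _ power]) auto
    have "(- S) ^ r * t ^ (n - r) * ((- of_nat q * t / S) ^ (r - k) * (- S / t) ^ (b - k))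
        = (- S) ^ r * t ^ (n - r) * ((of_nat q * t / (- S)) ^ (r - k) * (- S / t) ^ (b - k))"
      by simp
    also have "\<dots> = of_nat q ^ (r - k) * (((- S) ^ r * (- S) ^ (b - k)) / (- S) ^ (r - k))
        * ((t ^ (n - r) * t ^ (r - k)) / t ^ (b - k))"
      by (simp only: power_divide power_mult_distrib times_divide_eq_right times_divide_eq_left mult_ac
          divide_divide_eq_left)
    also have "\<dots> = of_nat q ^ (r - k) * ((- S) ^ b * t ^ (n - b))"
      unfolding pS pt using S0 t0 by simp
    finally show "of_nat (card {h \<in> ?F. \<forall>e\<in>B. h e = 0}) * ((- S) ^ card B * t ^ card (E - B))
        = (- S) ^ col_rk I G E * t ^ (card E - col_rk I G E) *
          ((- of_nat q * t / S) ^ (col_rk I G E - col_rk I G B) * (- S / t) ^ (card B - col_rk I G B))"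
      unfolding num card by (simp add: r_def k_def b_def n_def)
  qed
  also have "\<dots> = (- S) ^ col_rk I G E * t ^ (card E - col_rk I G E) *
      rank_poly (col_rk I G) E (- of_nat q * t / S) (- S / t)"
    by (simp add: rank_poly_def sum_distrib_left)
  finally show ?thesis unfolding t_def q_def .
qed

theorem theorem4p13:
  fixes \<tau> :: nat and \<rho> :: int and \<theta> :: real and \<omega> :: complex and E :: "'e set"
  assumes "\<tau> \<ge> 2" and "coprime \<rho> (2 * int \<tau>)"
    and "\<theta> = of_int \<rho> * pi / of_nat \<tau>" and "\<omega> = exp (\<i> * of_real \<theta>)"
    and "finite E"
  shows
    "(\<forall>(I :: 'i set) (J :: 'j set) (G :: 'i \<Rightarrow> 'e \<Rightarrow> int) (H :: 'j \<Rightarrow> 'e \<Rightarrow> int)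
       (D :: ('v, 'e) pre_digraph) (D' :: ('w, 'e) pre_digraph) (r :: nat) (q :: nat).
        finite I \<and> finite J \<and>
        regular_matrix D I E G \<and> regular_matrix D' J E H \<and>
        orthogonally_dual E I (rat_matrix G) J (rat_matrix H) \<and>
        r = col_rk I (rat_matrix G) E \<and>
        q = CARD('a :: {ab_group_add, finite})
        \<longrightarrow>
        (\<Sum>k<2 * \<tau>. \<omega> ^ k * of_nat (card (flow_pairs E
            (is_flow int_scale E J H :: ('e \<Rightarrow> 'a) \<Rightarrow> bool) 1 (\<tau> - 1) k (2 * \<tau>))))
        = (- 2 * \<i> * sin \<theta>) ^ r * (2 * \<i> * sin \<theta> + 2 - of_nat q) ^ (card E - r) *
          rank_poly (col_rk I (rat_matrix G)) E
            (- of_nat q * (2 * \<i> * sin \<theta> + 2 - of_nat q) / (2 * \<i> * sin \<theta>))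
            (- 2 * \<i> * sin \<theta> / (2 * \<i> * sin \<theta> + 2 - of_nat q)))
     \<and>
     (\<forall>(I :: 'i set) (J :: 'j set) (G :: 'i \<Rightarrow> 'e \<Rightarrow> 'k :: {field, finite})
       (H :: 'j \<Rightarrow> 'e \<Rightarrow> 'k) (p :: nat) (s :: nat) (r :: nat) (q :: nat).
        finite I \<and> finite J \<and>
        prime p \<and> s \<ge> 1 \<and> CARD('k) = p ^ s \<and>
        orthogonally_dual E I G J H \<and>
        r = col_rk I G E \<and>
        q = p ^ (s * CARD('d :: finite))
        \<longrightarrow>
        (\<Sum>k<2 * \<tau>. \<omega> ^ k * of_nat (card (flow_pairs E
            (is_flow (*s) E J H :: ('e \<Rightarrow> 'k ^ 'd) \<Rightarrow> bool) 1 (\<tau> - 1) k (2 * \<tau>))))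
        = (- 2 * \<i> * sin \<theta>) ^ r * (2 * \<i> * sin \<theta> + 2 - of_nat q) ^ (card E - r) *
          rank_poly (col_rk I G) E
            (- of_nat q * (2 * \<i> * sin \<theta> + 2 - of_nat q) / (2 * \<i> * sin \<theta>))
            (- 2 * \<i> * sin \<theta> / (2 * \<i> * sin \<theta> + 2 - of_nat q)))"
proof -
  define S where "S = 2 * \<i> * complex_of_real (sin \<theta>)"
  have \<omega>_cis: "\<omega> = cis \<theta>" using assms(4) by (simp add: cis_conv_exp)
  \<comment> \<open>Coprimality to 2 makes \<open>\<omega> ^ \<tau>\<close> equal to -1; coprimality
    to \<tau> keeps the sine nonzero.\<close>
  have "odd \<rho>" using assms(2) by (auto simp: coprime_mult_right_iff)
  have "\<omega> ^ \<tau> = cis (of_int \<rho> * pi)"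
    unfolding \<omega>_cis Complex.DeMoivre using assms(1,3) by simp
  also have "\<dots> = -1"
    using \<open>odd \<rho>\<close> by (simp add: complex_eq_iff cos_npi_int sin_npi_int mult.commute)
  finally have \<omega>_pow: "\<omega> ^ \<tau> = -1" .
  have S_\<omega>: "S = \<omega> - inverse \<omega>"
    by (simp add: S_def \<omega>_cis complex_eq_iff)
  \<comment> \<open>A zero of the sine would make \<rho> a multiple of \<tau>, which is at least
    2.\<close>
  have "sin \<theta> \<noteq> 0"
  proof
    assume "sin \<theta> = 0"
    then obtain n :: int where "\<theta> = of_int n * pi" by (auto simp: sin_zero_iff_int2)
    then have "(of_int \<rho> :: real) = of_int (n * int \<tau>)" using assms(1,3) by (simp add: field_simps)
    then have "\<rho> = n * int \<tau>" by (simp only: of_int_eq_iff)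
    then have "int \<tau> dvd \<rho>" "int \<tau> dvd 2 * int \<tau>" by auto
    then have "is_unit (int \<tau>)" using assms(2) coprime_common_divisor by blast
    then show False using assms(1) by simp
  qed
  then have S0: "S \<noteq> 0" by (simp add: S_def)
  have t0: "S + 2 - of_nat n \<noteq> 0" for n
    using \<open>sin \<theta> \<noteq> 0\<close> by (auto simp: S_def complex_eq_iff)
  note main = sum_flow_pairs_rank_poly[OF _ _ assms(5) _ _ _ \<omega>_pow _ S_\<omega> S0 t0]
  show ?thesis
  proof (intro conjI allI impI, goal_cases)
    case (1 I J G H D D' r q)
    then have H: "\<exists>C w. col_basis J H X C w \<and> card C = col_rk J (rat_matrix H) X" if "X \<subseteq> E" for X
      using regular_matrix_col_basis[of D' J E H X] that finite_subset[OF that assms(5)]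
        col_basis_col_rk[OF col_basis_rat_matrix] by metis
    have mod: "Modules.module (int_scale :: int \<Rightarrow> 'a \<Rightarrow> 'a)" by (rule module_int_scale)
    from 1 main[OF _ _ _ mod H, of I "rat_matrix G"] assms(1)
    show ?case by (simp add: S_def mult.assoc)
  next
    case (2 I J G H p s r q)
    then have H: "\<exists>C w. col_basis J H X C w \<and> card C = col_rk J H X" if "X \<subseteq> E" for X
      using col_basis_exists[of J X H] finite_subset[OF that assms(5)] col_basis_col_rk by metis
    have mod: "Modules.module ((*s) :: 'k \<Rightarrow> 'k ^ 'd \<Rightarrow> 'k ^ 'd)" by (rule module_vector_scalar_mult)
    \<comment> \<open>The size of \<open>'k ^ 'd\<close> is \<open>CARD('k)\<close> to the power
      \<open>CARD('d)\<close>, that is \<open>(p ^ s) ^ CARD('d)\<close>.\<close>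
    have "q = CARD('k ^ 'd)" using 2 by (simp add: power_mult)
    with 2 main[OF _ _ _ mod H, of I G] assms(1)
    show ?case by (simp add: S_def mult.assoc)
  qed
qed

end
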